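(* Let $R$ be a reduced ring of prime characteristic $p>0$ that has a $p$-basis $B$ over a subfield $k\subset R$. If $R^p$ and $k$ are linearly disjoint over $k^p$, then $B$ is a $p^e$-basis of $R$ over $k$ for all integers $e\geq 1$, and therefore $\mathrm{Der}_k(R)=\mathrm{IDer}_k(R)$.
   Context: Rings are commutative with unit. Let $R$ be a ring of prime characteristic $p$ and $k\subset R$ a subring. $p^e$-basis: for $e\ge 1$, $R^{p^e}=\{r^{p^e}\mid r\in R\}$ (similarly $k^p=\{c^p\mid c\in k\}$), and $R^{p^e}[k]$ is the subring of $R$ generated by $R^{p^e}$ and $k$. A subset $B\subset R$ (possibly infinite) is $p^e$-independent over $k$ if the family of monomials $B_e=\{b_1^{\alpha_1}\cdots b_m^{\alpha_m}\mid b_i\in B,\ b_i\neq b_j \text{ for } i\ne j,\ 0\leq \alpha_i<p^e\}$ (indexed by the finitely supported exponent functions) is linearly independent over $R^{p^e}[k]$. It is a $p^e$-basis of $R$ over $k$ if it is $p^e$-independent over $k$ and $R=R^{p^e}[k][B]$. A $p$-basis is the case $e=1$. Linear disjointness: if $K$ is a field and $K\subset S_1,S_2\subset\Omega$ are ring extensions, $S_1$ and $S_2$ are linearly disjoint over $K$ if the canonical map $S_1\otimes_K S_2\to\Omega$ is injective. Here $K=k^p$, $S_1=R^p$, $S_2=k$, $\Omega=R$. Integrable derivations: an HS-derivation of $R$ over $k$ of length $\infty$ is a sequence $D=(D_0,D_1,D_2,\ldots)$ of $k$-linear maps $D_\alpha:R\to R$ with $D_0=\mathrm{Id}_R$ and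 $D_\alpha(xy)=\sum_{i+j=\alpha}D_i(x)D_j(y)$ for all $x,y\in R$ and all $\alpha$. $\mathrm{Der}_k(R)$ is the module of $k$-derivations $R\to R$, and $\mathrm{IDer}_k(R)$ is the set of $\delta\in\mathrm{Der}_k(R)$ for which there is an HS-derivation $D$ of $R$ over $k$ of length $\infty$ with $D_1=\delta$. *)

theory Defs
  imports
    "HOL-Computational_Algebra.Computational_Algebra"
    "HOL-Library.Poly_Mapping"
begin

text \<open>
  The ambient ring \<open>R\<close> is the type \<open>'a :: comm_ring_1\<close>; its subrings and subfields are
  subsets of \<open>'a\<close>.
\<close>

section \<open>Subrings\<close>

definition is_subring :: "'a::comm_ring_1 set \<Rightarrow> bool" where
  "is_subring A \<longleftrightarrow>
     1 \<in> A \<and> (\<forall>x\<in>A. \<forall>y\<in>A. x - y \<in> A) \<and> (\<forall>x\<in>A. \<forall>y\<in>A. x * y \<in> A)"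

definition is_subfield :: "'a::comm_ring_1 set \<Rightarrow> bool" where
  "is_subfield k \<longleftrightarrow> is_subring k \<and> (\<forall>x\<in>k. x \<noteq> 0 \<longrightarrow> (\<exists>y\<in>k. x * y = 1))"

definition adjoin :: "'a::comm_ring_1 set \<Rightarrow> 'a set \<Rightarrow> 'a set" where
  "adjoin A S = is_subring hull (A \<union> S)"

definition pow_image :: "nat \<Rightarrow> 'a::comm_ring_1 set \<Rightarrow> 'a set" where
  "pow_image q A = (\<lambda>x. x ^ q) ` A"

definition reduced_ring :: "'a::comm_ring_1 itself \<Rightarrow> bool" where
  "reduced_ring _ \<longleftrightarrow> (\<forall>(x::'a) n. x ^ n = 0 \<longrightarrow> x = 0)"

section \<open>\<open>p\<^sup>e\<close>-bases\<close>

text \<open>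
  Linear independence of a family over a subring. The library's notion for modules takes the
  scalars to be a whole type, so it does not apply to a subring \<open>A\<close> of \<open>'a\<close>.
\<close>

definition lin_indep_family :: "'a::comm_ring_1 set \<Rightarrow> 'i set \<Rightarrow> ('i \<Rightarrow> 'a) \<Rightarrow> bool" where
  "lin_indep_family A I v \<longleftrightarrow>
     (\<forall>J c. finite J \<and> J \<subseteq> I \<and> (\<forall>i\<in>J. c i \<in> A) \<and> (\<Sum>i\<in>J. c i * v i) = 0
        \<longrightarrow> (\<forall>i\<in>J. c i = 0))"

definition exponents :: "nat \<Rightarrow> 'a set \<Rightarrow> ('a \<Rightarrow>\<^sub>0 nat) set" where
  "exponents q B = {\<alpha>. Poly_Mapping.keys \<alpha> \<subseteq> B \<and> (\<forall>b. Poly_Mapping.lookup \<alpha> b < q)}"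

definition monomial :: "('a::comm_ring_1 \<Rightarrow>\<^sub>0 nat) \<Rightarrow> 'a" where
  "monomial \<alpha> = (\<Prod>b\<in>Poly_Mapping.keys \<alpha>. b ^ Poly_Mapping.lookup \<alpha> b)"

definition pe_independent :: "nat \<Rightarrow> nat \<Rightarrow> 'a::comm_ring_1 set \<Rightarrow> 'a set \<Rightarrow> bool" where
  "pe_independent p e k B \<longleftrightarrow>
     lin_indep_family (adjoin (pow_image (p ^ e) UNIV) k) (exponents (p ^ e) B) monomial"

definition pe_basis :: "nat \<Rightarrow> nat \<Rightarrow> 'a::comm_ring_1 set \<Rightarrow> 'a set \<Rightarrow> bool" where
  "pe_basis p e k B \<longleftrightarrow>
     pe_independent p e k B \<and> adjoin (adjoin (pow_image (p ^ e) UNIV) k) B = UNIV"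

definition p_basis :: "nat \<Rightarrow> 'a::comm_ring_1 set \<Rightarrow> 'a set \<Rightarrow> bool" where
  "p_basis p k B \<longleftrightarrow> pe_basis p 1 k B"

section \<open>Linear disjointness\<close>

text \<open>
  For subrings \<open>K \<subseteq> S1 \<inter> S2\<close> of the ambient ring, the tensor product of \<open>S1\<close> and \<open>S2\<close>
  over \<open>K\<close> is the free abelian group on \<open>S1 \<times> S2\<close> (formal integer combinations) modulo the
  subgroup generated by the biadditivity and \<open>K\<close>-balancing relations. Its elements are
  equivalence classes.
\<close>

definition tensor_relators ::
    "'a::comm_ring_1 set \<Rightarrow> 'a set \<Rightarrow> 'a set \<Rightarrow> ('a \<times> 'a \<Rightarrow>\<^sub>0 int) set" where
  "tensor_relators K S1 S2 =
     {frag_of (s + s', t) - frag_of (s, t) - frag_of (s', t) | s s' t.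
        s \<in> S1 \<and> s' \<in> S1 \<and> t \<in> S2} \<union>
     {frag_of (s, t + t') - frag_of (s, t) - frag_of (s, t') | s t t'.
        s \<in> S1 \<and> t \<in> S2 \<and> t' \<in> S2} \<union>
     {frag_of (s * c, t) - frag_of (s, c * t) | s c t.
        s \<in> S1 \<and> c \<in> K \<and> t \<in> S2}"

definition tensor_rel ::
    "'a::comm_ring_1 set \<Rightarrow> 'a set \<Rightarrow> 'a set \<Rightarrow> (('a \<times> 'a \<Rightarrow>\<^sub>0 int) \<times> ('a \<times> 'a \<Rightarrow>\<^sub>0 int)) set" where
  "tensor_rel K S1 S2 =
     {(f, g). Poly_Mapping.keys f \<subseteq> S1 \<times> S2 \<and> Poly_Mapping.keys g \<subseteq> S1 \<times> S2 \<and>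
        f - g \<in> group_closure (tensor_relators K S1 S2)}"

definition tensor_product ::
    "'a::comm_ring_1 set \<Rightarrow> 'a set \<Rightarrow> 'a set \<Rightarrow> ('a \<times> 'a \<Rightarrow>\<^sub>0 int) set set" where
  "tensor_product K S1 S2 = {f. Poly_Mapping.keys f \<subseteq> S1 \<times> S2} // tensor_rel K S1 S2"

definition mult_eval :: "('a::comm_ring_1 \<times> 'a \<Rightarrow>\<^sub>0 int) \<Rightarrow> 'a" where
  "mult_eval f = (\<Sum>z\<in>Poly_Mapping.keys f. of_int (Poly_Mapping.lookup f z) * (fst z * snd z))"

text \<open>
  The canonical map, sending the class of \<open>s \<otimes> t\<close> to \<open>s * t\<close>. It is well defined:
  \<open>mult_eval\<close> is constant on every class (lemma \<open>tensor_map_class\<close> below).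
\<close>

definition tensor_map :: "('a::comm_ring_1 \<times> 'a \<Rightarrow>\<^sub>0 int) set \<Rightarrow> 'a" where
  "tensor_map C = the_elem (mult_eval ` C)"

definition linearly_disjoint :: "'a::comm_ring_1 set \<Rightarrow> 'a set \<Rightarrow> 'a set \<Rightarrow> bool" where
  "linearly_disjoint K S1 S2 \<longleftrightarrow> inj_on tensor_map (tensor_product K S1 S2)"

lemma mult_eval_superset:
  assumes "finite Z" "Poly_Mapping.keys f \<subseteq> Z"
  shows "mult_eval f = (\<Sum>z\<in>Z. of_int (Poly_Mapping.lookup f z) * (fst z * snd z))"
  unfolding mult_eval_def
  by (rule sum.mono_neutral_left) (use assms in \<open>auto simp: in_keys_iff\<close>)

lemma mult_eval_frag_of [simp]: "mult_eval (frag_of (s, t)) = s * t"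
  by (simp add: mult_eval_def)

lemma mult_eval_diff: "mult_eval (f - g) = mult_eval f - mult_eval g"
proof -
  let ?Z = "Poly_Mapping.keys f \<union> Poly_Mapping.keys g"
  have "Poly_Mapping.keys (f - g) \<subseteq> ?Z" by (rule keys_diff)
  then show ?thesis
    by (simp add: mult_eval_superset [where Z = ?Z] lookup_minus left_diff_distrib sum_subtractf)
qed

lemma mult_eval_group_closure:
  assumes "f \<in> group_closure (tensor_relators K S1 S2)"
  shows "mult_eval f = 0"
  using assms
proof induction
  case (base f)
  have "mult_eval (0 :: 'a \<times> 'a \<Rightarrow>\<^sub>0 int) = 0" by (simp add: mult_eval_def)
  with base show ?case
    by (auto simp: tensor_relators_def mult_eval_diff distrib_left distrib_right mult.assoc)
qed (simp add: mult_eval_diff)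

lemma equiv_tensor_rel: "equiv {f. Poly_Mapping.keys f \<subseteq> S1 \<times> S2} (tensor_rel K S1 S2)"
proof (rule equivI)
  show "sym (tensor_rel K S1 S2)"
  proof (rule symI)
    fix f g assume "(f, g) \<in> tensor_rel K S1 S2"
    then show "(g, f) \<in> tensor_rel K S1 S2"
      using group_closure_minus_iff [of "f - g" "tensor_relators K S1 S2"]
      by (simp add: tensor_rel_def)
  qed
  show "trans (tensor_rel K S1 S2)"
  proof (rule transI)
    fix f g h assume "(f, g) \<in> tensor_rel K S1 S2" "(g, h) \<in> tensor_rel K S1 S2"
    then show "(f, h) \<in> tensor_rel K S1 S2"
      using group_closure_add [of "f - g" "tensor_relators K S1 S2" "g - h"]
      by (simp add: tensor_rel_def)
  qed
qed (auto simp: tensor_rel_def refl_on_def)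

lemma tensor_map_class:
  assumes "C \<in> tensor_product K S1 S2" "f \<in> C"
  shows "tensor_map C = mult_eval f"
proof -
  have "mult_eval g = mult_eval f" if "g \<in> C" for g
  proof -
    have "(g, f) \<in> tensor_rel K S1 S2"
      using quotient_eq_iff [OF equiv_tensor_rel, of C S1 S2 K C g f] assms that
      by (simp add: tensor_product_def)
    then show ?thesis
      using mult_eval_group_closure [of "g - f" K S1 S2]
      by (simp add: tensor_rel_def mult_eval_diff)
  qed
  then have "mult_eval ` C = {mult_eval f}" using assms(2) by blast
  then show ?thesis by (simp add: tensor_map_def)
qed

section \<open>Derivations and Hasse--Schmidt derivations\<close>

definition k_linear :: "'a::comm_ring_1 set \<Rightarrow> ('a \<Rightarrow> 'a) \<Rightarrow> bool" where
  "k_linear k f \<longleftrightarrow> (\<forall>x y. f (x + y) = f x + f y) \<and> (\<forall>c\<in>k. \<forall>x. f (c * x) = c * f x)"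

definition Der :: "'a::comm_ring_1 set \<Rightarrow> ('a \<Rightarrow> 'a) set" where
  "Der k = {\<delta>. k_linear k \<delta> \<and> (\<forall>x y. \<delta> (x * y) = x * \<delta> y + \<delta> x * y)}"

definition HS_derivation :: "'a::comm_ring_1 set \<Rightarrow> (nat \<Rightarrow> 'a \<Rightarrow> 'a) \<Rightarrow> bool" where
  "HS_derivation k D \<longleftrightarrow>
     (\<forall>n. k_linear k (D n)) \<and> D 0 = id \<and>
     (\<forall>n x y. D n (x * y) = (\<Sum>i\<le>n. D i x * D (n - i) y))"

definition IDer :: "'a::comm_ring_1 set \<Rightarrow> ('a \<Rightarrow> 'a) set" where
  "IDer k = {\<delta> \<in> Der k. \<exists>D. HS_derivation k D \<and> D 1 = \<delta>}"

end

theory Submission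
  imports Defs
begin

text \<open>
  For independence, a relation between the monomials of exponents below \<open>p\<^sup>e\<^sup>+\<^sup>1\<close> is split
  along \<open>\<alpha> = p \<beta> + \<gamma>\<close>; \<open>p\<close>-independence separates the \<open>\<gamma>\<close>. A basis of \<open>k\<close> over
  \<open>k\<^sup>p\<close> stays independent over \<open>R\<^sup>p\<close> by linear disjointness, so what remains is a family
  of \<open>p\<close>-th powers that vanish; since \<open>R\<close> is reduced, taking roots gives relations of
  exponents below \<open>p\<^sup>e\<close>, and induction applies.

  For integrability, freeness on the reduced monomials gives a linear map \<open>\<phi>\<^sub>e\<close> from \<open>R\<close> to
  \<open>R[[X]]\<close> with \<open>b \<mapsto> b + \<delta>(b) X\<close> for \<open>b\<close> in \<open>B\<close>. It is multiplicative modulo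
  \<open>X\<close> to the power \<open>p\<^sup>e\<close>, because \<open>b + \<delta>(b) X\<close> and \<open>b\<close> have there the same
  \<open>p\<^sup>e\<close>-th power. The \<open>\<phi>\<^sub>e\<close> are compatible, and their limit is the required
  Hasse--Schmidt derivation.
\<close>

section \<open>Closure properties of subrings and minimality of \<open>adjoin\<close>\<close>

section \<open>Subrings\<close>

lemma is_subringD:
  assumes "is_subring A"
  shows "1 \<in> A" "0 \<in> A" "x \<in> A \<Longrightarrow> y \<in> A \<Longrightarrow> x - y \<in> A" "x \<in> A \<Longrightarrow> y \<in> A \<Longrightarrow> x * y \<in> A"
    "x \<in> A \<Longrightarrow> - x \<in> A" "x \<in> A \<Longrightarrow> y \<in> A \<Longrightarrow> x + y \<in> A" "x \<in> A \<Longrightarrow> x ^ n \<in> A"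
proof -
  show 1: "1 \<in> A"
    using assms by (simp add: is_subring_def)
  show diff: "x - y \<in> A" if "x \<in> A" "y \<in> A" for x y
    using assms that by (simp add: is_subring_def)
  show mult: "x * y \<in> A" if "x \<in> A" "y \<in> A" for x y
    using assms that by (simp add: is_subring_def)
  show 0: "0 \<in> A"
    using diff [OF 1 1] by simp
  show uminus: "- x \<in> A" if "x \<in> A" for x
    using diff [OF 0 that] by simp
  show "x + y \<in> A" if "x \<in> A" "y \<in> A"
    using diff [OF that(1) uminus [OF that(2)]] by simp
  show "x ^ n \<in> A" if "x \<in> A"
    by (induction n) (auto simp: 1 mult that)
qed

lemma is_subring_adjoin: "is_subring (adjoin A S)"
  unfolding adjoin_def by (rule hull_in) (auto simp: is_subring_def)

lemma adjoin_superset: "A \<subseteq> adjoin A S" "S \<subseteq> adjoin A S"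
  using hull_subset [of "A \<union> S" is_subring] by (auto simp: adjoin_def)

lemma adjoin_minimal:
  assumes "is_subring C" "A \<subseteq> C" "S \<subseteq> C"
  shows "adjoin A S \<subseteq> C"
  unfolding adjoin_def by (rule hull_minimal) (use assms in auto)

lemma pow_imageI: "x \<in> A \<Longrightarrow> x ^ q \<in> pow_image q A"
  by (simp add: pow_image_def)

lemma pow_image_1 [simp]: "pow_image 1 A = A" "pow_image (Suc 0) A = A"
  by (simp_all add: pow_image_def)

section \<open>Free families over a subring: coordinates, linear extension, bases over a
  subfield\<close>

section \<open>Linear combinations\<close>

text \<open>The scalar map \<open>g\<close> is a parameter so that one formula serves for linear
  combinations (\<open>g\<close> the identity), for evaluating formal integer combinations
  (\<open>of_int\<close>) and for maps into power series that are linear along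
  \<open>fps_const\<close>.\<close>

definition lin_ext :: "('c::zero \<Rightarrow> 'b::comm_ring_1) \<Rightarrow> ('i \<Rightarrow> 'b) \<Rightarrow> ('i \<Rightarrow>\<^sub>0 'c) \<Rightarrow> 'b" where
  "lin_ext g h f = (\<Sum>i\<in>Poly_Mapping.keys f. g (Poly_Mapping.lookup f i) * h i)"

lemma lin_ext_superset:
  assumes "g 0 = 0" "finite Z" "Poly_Mapping.keys f \<subseteq> Z"
  shows "lin_ext g h f = (\<Sum>i\<in>Z. g (Poly_Mapping.lookup f i) * h i)"
  unfolding lin_ext_def
  by (rule sum.mono_neutral_left) (use assms in \<open>auto simp: in_keys_iff\<close>)

lemma lin_ext_zero [simp]: "lin_ext g h 0 = 0"
  by (simp add: lin_ext_def)

lemma lin_ext_single: "g 0 = 0 \<Longrightarrow> lin_ext g h (Poly_Mapping.single i c) = g c * h i"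
  by (simp add: lin_ext_def)

lemma lin_ext_add:
  fixes g :: "'c::comm_monoid_add \<Rightarrow> 'b::comm_ring_1"
  assumes "g 0 = 0" "\<And>a b. g (a + b) = g a + g b"
  shows "lin_ext g h (f + f') = lin_ext g h f + lin_ext g h f'"
proof -
  let ?Z = "Poly_Mapping.keys f \<union> Poly_Mapping.keys f'"
  have "Poly_Mapping.keys (f + f') \<subseteq> ?Z" by (rule keys_add)
  then show ?thesis
    by (simp add: lin_ext_superset [where Z = ?Z] assms lookup_add distrib_right sum.distrib)
qed

lemma lin_ext_diff:
  fixes g :: "'c::ab_group_add \<Rightarrow> 'b::comm_ring_1"
  assumes "g 0 = 0" "\<And>a b. g (a + b) = g a + g b"
  shows "lin_ext g h (f - f') = lin_ext g h f - lin_ext g h f'"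
  using lin_ext_add [of g h "f - f'" f', OF assms] by (simp add: algebra_simps)

lemma lin_ext_sum:
  fixes g :: "'c::comm_monoid_add \<Rightarrow> 'b::comm_ring_1"
  assumes "g 0 = 0" "\<And>a b. g (a + b) = g a + g b"
  shows "lin_ext g h (\<Sum>j\<in>J. F j) = (\<Sum>j\<in>J. lin_ext g h (F j))"
  by (induction J rule: infinite_finite_induct) (simp_all add: lin_ext_add assms)

lemma lin_ext_map_mult:
  fixes g :: "'c::comm_ring_1 \<Rightarrow> 'b::comm_ring_1"
  assumes "g 0 = 0" "\<And>a b. g (a * b) = g a * g b"
  shows "lin_ext g h (Poly_Mapping.map ((*) a) f) = g a * lin_ext g h f"
proof -
  have "Poly_Mapping.keys (Poly_Mapping.map ((*) a) f) \<subseteq> Poly_Mapping.keys f"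
    by (auto simp: in_keys_iff Poly_Mapping.map.rep_eq when_def)
  moreover have "Poly_Mapping.lookup (Poly_Mapping.map ((*) a) f) i = a * Poly_Mapping.lookup f i" for i
    by (auto simp: Poly_Mapping.map.rep_eq when_def)
  ultimately show ?thesis
    by (simp add: lin_ext_superset [where Z = "Poly_Mapping.keys f"] assms sum_distrib_left mult.assoc)
qed

lemma mult_eval_eq_lin_ext: "mult_eval f = lin_ext of_int (\<lambda>z. fst z * snd z) f"
  by (simp add: mult_eval_def lin_ext_def)

text \<open>Built one term at a time, with repeated indices allowed, so that closure properties
  follow by induction; \<open>span_family_combs\<close> afterwards collects the terms into one
  coefficient per index.\<close>

inductive_set span_family :: "'a::comm_ring_1 set \<Rightarrow> 'i set \<Rightarrow> ('i \<Rightarrow> 'a) \<Rightarrow> 'a set"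
  for A I v where
    zero: "0 \<in> span_family A I v"
  | step: "i \<in> I \<Longrightarrow> a \<in> A \<Longrightarrow> x \<in> span_family A I v \<Longrightarrow> a * v i + x \<in> span_family A I v"

lemma span_family_add:
  "x \<in> span_family A I v \<Longrightarrow> y \<in> span_family A I v \<Longrightarrow> x + y \<in> span_family A I v"
  by (induction rule: span_family.induct) (auto simp: add.assoc intro: span_family.intros)

lemma span_family_scale:
  assumes "is_subring A" "a \<in> A"
  shows "x \<in> span_family A I v \<Longrightarrow> a * x \<in> span_family A I v"
  by (induction rule: span_family.induct)
    (auto simp: distrib_left mult.assoc [symmetric] intro: span_family.intros is_subringD assms)

lemma span_family_diff:
  assumes "is_subring A" "x \<in> span_family A I v" "y \<in> span_family A I v"
  shows "x - y \<in> span_family A I v"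
  using span_family_add [OF assms(2) span_family_scale [OF assms(1) _ assms(3), of "- 1"]] assms(1)
  by (simp add: is_subringD)

lemma span_family_mono:
  assumes "A \<subseteq> A'"
  shows "span_family A I v \<subseteq> span_family A' I v"
proof
  fix x assume "x \<in> span_family A I v"
  then show "x \<in> span_family A' I v"
    by induction (use assms in \<open>auto intro: span_family.intros\<close>)
qed

lemma span_family_base:
  assumes "is_subring A" "i \<in> I"
  shows "v i \<in> span_family A I v"
  using span_family.step [OF assms(2) is_subringD(1) [OF assms(1)] span_family.zero] by simp

lemma span_family_sum:
  assumes "finite J" "J \<subseteq> I" "\<forall>i\<in>J. c i \<in> A"
  shows "(\<Sum>i\<in>J. c i * v i) \<in> span_family A I v"
  using assms by induction (auto intro: span_family.intros)

lemma lin_indep_familyD: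
  assumes "lin_indep_family A I v" "finite J" "J \<subseteq> I" "\<And>i. i \<in> J \<Longrightarrow> c i \<in> A"
    "(\<Sum>i\<in>J. c i * v i) = 0" "i \<in> J"
  shows "c i = 0"
proof -
  have "finite J \<and> J \<subseteq> I \<and> (\<forall>i\<in>J. c i \<in> A) \<and> (\<Sum>i\<in>J. c i * v i) = 0"
    using assms by blast
  then have "\<forall>i\<in>J. c i = 0"
    by (rule assms(1) [unfolded lin_indep_family_def, THEN spec, THEN spec, THEN mp])
  then show ?thesis
    using assms(6) ..
qed

text \<open>For a subring \<open>A\<close> this is the free \<open>A\<close>-module on
  \<open>I\<close>, cut out of the finitely supported functions by a condition on their
  values.\<close>

definition combs :: "'c::zero set \<Rightarrow> 'i set \<Rightarrow> ('i \<Rightarrow>\<^sub>0 'c) set" where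
  "combs A I = {f. Poly_Mapping.keys f \<subseteq> I \<and> (\<forall>i. Poly_Mapping.lookup f i \<in> A)}"

lemma combs_add: "is_subring A \<Longrightarrow> f \<in> combs A I \<Longrightarrow> g \<in> combs A I \<Longrightarrow> f + g \<in> combs A I"
  using keys_add [of f g] by (auto simp: combs_def lookup_add is_subringD)

lemma combs_diff: "is_subring A \<Longrightarrow> f \<in> combs A I \<Longrightarrow> g \<in> combs A I \<Longrightarrow> f - g \<in> combs A I"
  using keys_diff [of f g] by (auto simp: combs_def lookup_minus is_subringD)

lemma combs_map_mult:
  "is_subring A \<Longrightarrow> a \<in> A \<Longrightarrow> f \<in> combs A I \<Longrightarrow> Poly_Mapping.map ((*) a) f \<in> combs A I"
  by (auto simp: combs_def in_keys_iff subset_iff Poly_Mapping.map.rep_eq when_def is_subringD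
      split: if_splits)

lemma combs_single:
  "is_subring A \<Longrightarrow> i \<in> I \<Longrightarrow> a \<in> A \<Longrightarrow> Poly_Mapping.single i a \<in> combs A I"
  by (auto simp: combs_def lookup_single when_def is_subringD)

lemma lin_ext_id_inj:
  assumes "is_subring A" "lin_indep_family A I v" "f \<in> combs A I" "g \<in> combs A I"
    and "lin_ext (\<lambda>a. a) v f = lin_ext (\<lambda>a. a) v g"
  shows "f = g"
proof (rule poly_mapping_eqI)
  fix i
  have fg: "f - g \<in> combs A I"
    using assms by (intro combs_diff)
  have "lin_ext (\<lambda>a. a) v (f - g) = 0"
    using assms(5) by (simp add: lin_ext_diff)
  then have "Poly_Mapping.lookup (f - g) i = 0" if "i \<in> Poly_Mapping.keys (f - g)"
    using fg that lin_indep_familyD [OF assms(2), of "Poly_Mapping.keys (f - g)"]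
    by (simp add: lin_ext_def combs_def)
  then have "Poly_Mapping.lookup (f - g) i = 0"
    by (auto simp: in_keys_iff)
  then show "Poly_Mapping.lookup f i = Poly_Mapping.lookup g i"
    by (simp add: lookup_minus)
qed

lemma span_family_combs:
  assumes "is_subring A" "x \<in> span_family A I v"
  shows "\<exists>f\<in>combs A I. x = lin_ext (\<lambda>a. a) v f"
  using assms(2)
proof induction
  case zero
  have "0 \<in> combs A I"
    using assms(1) by (simp add: combs_def is_subringD)
  then show ?case
    by (metis lin_ext_zero)
next
  case (step i a x)
  then obtain f where "f \<in> combs A I" "x = lin_ext (\<lambda>a. a) v f"
    by blast
  then show ?case
    using step assms(1)
    by (intro bexI [of _ "Poly_Mapping.single i a + f"])
       (auto simp: lin_ext_add lin_ext_single combs_add combs_single)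
qed

text \<open>Coefficients exist by the definition of the span and are unique by independence. Each
  formula for \<open>c\<close> is therefore verified by recombining its right-hand side. Outside the
  span \<open>c\<close> is arbitrary, hence the restrictions on \<open>x\<close> and
  \<open>y\<close>.\<close>

lemma coordinates:
  assumes A: "is_subring A" and "lin_indep_family A I v"
  obtains c where
    "\<And>x. x \<in> span_family A I v \<Longrightarrow> c x \<in> combs A I \<and> lin_ext (\<lambda>a. a) v (c x) = x"
    "\<And>x y. x \<in> span_family A I v \<Longrightarrow> y \<in> span_family A I v \<Longrightarrow> c (x + y) = c x + c y"
    "\<And>a x. a \<in> A \<Longrightarrow> x \<in> span_family A I v \<Longrightarrow> c (a * x) = Poly_Mapping.map ((*) a) (c x)"
    "\<And>i. i \<in> I \<Longrightarrow> c (v i) = Poly_Mapping.single i 1"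
proof -
  obtain c where c: "\<And>x. x \<in> span_family A I v \<Longrightarrow> c x \<in> combs A I \<and> lin_ext (\<lambda>a. a) v (c x) = x"
    using span_family_combs [OF A] by metis
  have uniq: "c x = f" if "x \<in> span_family A I v" "f \<in> combs A I" "lin_ext (\<lambda>a. a) v f = x" for x f
    using lin_ext_id_inj [OF assms, of "c x" f] c [OF that(1)] that(2,3) by simp
  show thesis
  proof
    show "c (x + y) = c x + c y" if "x \<in> span_family A I v" "y \<in> span_family A I v" for x y
      using c [OF that(1)] c [OF that(2)] A that
      by (intro uniq) (auto simp: span_family_add combs_add lin_ext_add)
    show "c (a * x) = Poly_Mapping.map ((*) a) (c x)" if "a \<in> A" "x \<in> span_family A I v" for a x
      using c [OF that(2)] A that
      by (intro uniq) (auto simp: span_family_scale combs_map_mult lin_ext_map_mult)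
    show "c (v i) = Poly_Mapping.single i 1" if "i \<in> I" for i
      using A that
      by (intro uniq) (auto simp: span_family_base combs_single lin_ext_single is_subringD)
  qed (use c in blast)
qed

text \<open>Take coordinates, push them through the ring homomorphism \<open>g\<close>, and
  recombine them with the prescribed images \<open>w\<close>.\<close>

lemma linear_extension:
  fixes A :: "'a::comm_ring_1 set" and g :: "'a \<Rightarrow> 'b::comm_ring_1"
  assumes "is_subring A" and "lin_indep_family A I v"
    and g: "g 0 = 0" "g 1 = 1" "\<And>a b. g (a + b) = g a + g b" "\<And>a b. g (a * b) = g a * g b"
  obtains \<phi> where
    "\<And>x y. x \<in> span_family A I v \<Longrightarrow> y \<in> span_family A I v \<Longrightarrow> \<phi> (x + y) = \<phi> x + \<phi> y"
    "\<And>a x. a \<in> A \<Longrightarrow> x \<in> span_family A I v \<Longrightarrow> \<phi> (a * x) = g a * \<phi> x"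
    "\<And>i. i \<in> I \<Longrightarrow> \<phi> (v i) = w i"
proof -
  obtain c where c:
    "\<And>x y. x \<in> span_family A I v \<Longrightarrow> y \<in> span_family A I v \<Longrightarrow> c (x + y) = c x + c y"
    "\<And>a x. a \<in> A \<Longrightarrow> x \<in> span_family A I v \<Longrightarrow> c (a * x) = Poly_Mapping.map ((*) a) (c x)"
    "\<And>i. i \<in> I \<Longrightarrow> c (v i) = Poly_Mapping.single i 1"
    using coordinates [OF assms(1,2)] by metis
  show thesis
    by (rule that [of "\<lambda>x. lin_ext g w (c x)"])
       (simp_all add: c g lin_ext_add lin_ext_map_mult lin_ext_single)
qed

text \<open>By Zorn's lemma \<open>S\<close> has a maximal independent subset. It spans
  \<open>S\<close>: an element \<open>t\<close> outside its span could be adjoined, because in a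
  relation a nonzero coefficient of \<open>t\<close> is invertible in \<open>K\<close> and would put
  \<open>t\<close> into the span.\<close>

lemma subfield_basis:
  fixes K S :: "'a::comm_ring_1 set"
  assumes K: "is_subfield K"
  obtains L where "L \<subseteq> S" "lin_indep_family K L (\<lambda>x. x)" "S \<subseteq> span_family K L (\<lambda>x. x)"
proof -
  have ring: "is_subring K"
    using K by (simp add: is_subfield_def)
  define \<I> where "\<I> = {L. L \<subseteq> S \<and> lin_indep_family K L (\<lambda>x. x)}"
  have "\<Union>C \<in> \<I>" if C: "subset.chain \<I> C" for C
  proof -
    have sub: "C \<subseteq> \<I>"
      using C by (simp add: subset.chain_def)
    have "lin_indep_family K (\<Union>C) (\<lambda>x. x)"
      unfolding lin_indep_family_def
    proof (intro allI impI, elim conjE)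
      fix J c assume J: "finite J" "J \<subseteq> \<Union>C" "\<forall>i\<in>J. c i \<in> K" "(\<Sum>i\<in>J. c i * i) = 0"
      show "\<forall>i\<in>J. c i = 0"
      proof (cases "C = {}")
        case True
        then show ?thesis using J by simp
      next
        case False
        obtain X where "X \<in> C" "J \<subseteq> X"
          by (rule finite_subset_Union_chain [OF J(1,2) False C])
        have "lin_indep_family K X (\<lambda>x. x)"
          using sub \<open>X \<in> C\<close> by (auto simp: \<I>_def)
        from lin_indep_familyD [OF this J(1) \<open>J \<subseteq> X\<close> _ J(4)] show ?thesis
          using J(3) by blast
      qed
    qed
    then show ?thesis
      using sub by (auto simp: \<I>_def)
  qed
  then obtain L where L: "L \<in> \<I>" and max: "\<And>X. X \<in> \<I> \<Longrightarrow> L \<subseteq> X \<Longrightarrow> X = L"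
    using subset_Zorn' [of \<I>] by blast
  have indep: "lin_indep_family K L (\<lambda>x. x)" and "L \<subseteq> S"
    using L by (auto simp: \<I>_def)
  have "t \<in> span_family K L (\<lambda>x. x)" if "t \<in> S" for t
  proof (rule ccontr)
    assume t: "t \<notin> span_family K L (\<lambda>x. x)"
    have "lin_indep_family K (insert t L) (\<lambda>x. x)"
      unfolding lin_indep_family_def
    proof (intro allI impI, elim conjE)
      fix J c
      assume J: "finite J" "J \<subseteq> insert t L" "\<forall>i\<in>J. c i \<in> K" "(\<Sum>i\<in>J. c i * i) = 0"
      have rest: "(\<Sum>i\<in>J - {t}. c i * i) \<in> span_family K L (\<lambda>x. x)"
        using J by (intro span_family_sum) auto
      have ct: "c t = 0" if "t \<in> J"
      proof (rule ccontr)
        assume "c t \<noteq> 0"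
        then obtain d where d: "d \<in> K" "c t * d = 1"
          using K J(3) \<open>t \<in> J\<close> by (auto simp: is_subfield_def)
        have "c t * t + (\<Sum>i\<in>J - {t}. c i * i) = 0"
          using J(1,4) \<open>t \<in> J\<close> by (simp add: sum.remove)
        then have "d * (c t * t) = - d * (\<Sum>i\<in>J - {t}. c i * i)"
          by (simp add: eq_neg_iff_add_eq_0 distrib_left [symmetric])
        moreover have "d * (c t * t) = t"
          using d(2) by (metis mult.assoc mult.commute mult_1)
        ultimately have "t = - d * (\<Sum>i\<in>J - {t}. c i * i)"
          by simp
        moreover have "- d * (\<Sum>i\<in>J - {t}. c i * i) \<in> span_family K L (\<lambda>x. x)"
          by (rule span_family_scale [OF ring is_subringD(5) [OF ring d(1)] rest])
        ultimately show False
          using t by simp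
      qed
      moreover have "\<forall>i\<in>J - {t}. c i = 0"
      proof -
        have "(\<Sum>i\<in>J - {t}. c i * i) = (\<Sum>i\<in>J. c i * i)"
          using J(1) ct by (intro sum.mono_neutral_left) auto
        then have "(\<Sum>i\<in>J - {t}. c i * i) = 0"
          using J(4) by simp
        moreover have "finite (J - {t})" "J - {t} \<subseteq> L" "\<forall>i\<in>J - {t}. c i \<in> K"
          using J by auto
        ultimately show ?thesis
          using lin_indep_familyD [OF indep, of "J - {t}" c] by blast
      qed
      ultimately show "\<forall>i\<in>J. c i = 0"
        by blast
    qed
    then have "insert t L = L"
      using max [of "insert t L"] L that by (auto simp: \<I>_def)
    then have "t \<in> L"
      by blast
    then show False
      using t span_family_base [OF ring, of t L "\<lambda>x. x"] by simp
  qed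
  then show thesis
    using that indep \<open>L \<subseteq> S\<close> by blast
qed

section \<open>From injectivity on the tensor product to independence over the other factor\<close>

section \<open>Linear disjointness\<close>

text \<open>Injectivity on classes is turned into a statement about formal sums: the classes of
  \<open>f\<close> and of \<open>0\<close> have the same image, so they coincide, and
  \<open>f - 0\<close> lies in the subgroup of relators.\<close>

lemma linearly_disjoint_mult_eval_zero:
  assumes "linearly_disjoint K S1 S2"
    and "Poly_Mapping.keys f \<subseteq> S1 \<times> S2" "mult_eval f = 0"
  shows "f \<in> group_closure (tensor_relators K S1 S2)"
proof -
  let ?R = "tensor_rel K S1 S2" and ?F = "{f. Poly_Mapping.keys f \<subseteq> S1 \<times> S2}"
  have C: "?R `` {g} \<in> tensor_product K S1 S2" "g \<in> ?R `` {g}" if "g \<in> ?F" for g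
    using that equiv_class_self [OF equiv_tensor_rel that]
    by (auto simp: tensor_product_def intro: quotientI)
  have f: "f \<in> ?F" and zero: "0 \<in> ?F"
    using assms(2) by simp_all
  have "tensor_map (?R `` {f}) = 0"
    using tensor_map_class [OF C [OF f]] assms(3) by simp
  also have "0 = tensor_map (?R `` {0})"
    using tensor_map_class [OF C [OF zero]] by (simp add: mult_eval_eq_lin_ext)
  finally have "?R `` {f} = ?R `` {0}"
    using assms(1) C(1) [OF f] C(1) [OF zero] unfolding linearly_disjoint_def
    by (meson inj_onD)
  then have "(f, 0) \<in> ?R"
    using eq_equiv_class [OF _ equiv_tensor_rel zero] by blast
  then show ?thesis
    by (simp add: tensor_rel_def)
qed

text \<open>
  The coordinate functionals of \<open>S2\<close> over \<open>K\<close> induce additive functionals on the tensor product;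
  these read off the coefficients of a relation, which is a tensor in the kernel of the
  canonical map.
\<close>

lemma linearly_disjoint_imp_lin_indep:
  assumes ld: "linearly_disjoint K S1 S2" and K: "is_subring K"
    and indep: "lin_indep_family K I v" and v: "v ` I \<subseteq> S2" and span: "S2 \<subseteq> span_family K I v"
  shows "lin_indep_family S1 I v"
  unfolding lin_indep_family_def
proof (intro allI impI ballI, elim conjE)
  fix J c j
  assume J: "finite J" "J \<subseteq> I" "\<forall>i\<in>J. c i \<in> S1" "(\<Sum>i\<in>J. c i * v i) = 0" and j: "j \<in> J"
  obtain co where co:
    "\<And>x y. x \<in> span_family K I v \<Longrightarrow> y \<in> span_family K I v \<Longrightarrow> co (x + y) = co x + co y"
    "\<And>a x. a \<in> K \<Longrightarrow> x \<in> span_family K I v \<Longrightarrow> co (a * x) = Poly_Mapping.map ((*) a) (co x)"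
    "\<And>i. i \<in> I \<Longrightarrow> co (v i) = Poly_Mapping.single i 1"
    using coordinates [OF K indep] by metis
  \<comment> \<open>The given relation becomes the formal tensor with terms \<open>c i\<close> times
    \<open>v i\<close>; \<open>\<Phi>\<close> multiplies the first factor by the \<open>j\<close>-th
    coordinate of the second.\<close>
  define f where "f = (\<Sum>i\<in>J. frag_of (c i, v i))"
  define \<Phi> where "\<Phi> = lin_ext of_int (\<lambda>(s, t). s * Poly_Mapping.lookup (co t) j)"
  have diff: "\<Phi> (g - g') = \<Phi> g - \<Phi> g'" for g g'
    by (simp add: \<Phi>_def lin_ext_diff)
  have single: "\<Phi> (frag_of (s, t)) = s * Poly_Mapping.lookup (co t) j" for s t
    by (simp add: \<Phi>_def lin_ext_single)
  \<comment> \<open>Biadditivity relators vanish because coordinates are additive, balancing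
    relators because they are \<open>K\<close>-linear; both hold on \<open>S2\<close>, which lies in
    the span.\<close>
  have "\<Phi> g = 0" if "g \<in> group_closure (tensor_relators K S1 S2)" for g
    using that
  proof induction
    case (base g)
    have "\<Phi> 0 = 0"
      by (simp add: \<Phi>_def)
    with base span show ?case
      by (auto simp: tensor_relators_def diff single co subset_iff lookup_add distrib_left
          distrib_right mult.assoc Poly_Mapping.map.rep_eq when_def)
  qed (simp add: diff)
  moreover have "f \<in> group_closure (tensor_relators K S1 S2)"
  proof (rule linearly_disjoint_mult_eval_zero [OF ld])
    have "Poly_Mapping.keys f \<subseteq> (\<Union>i\<in>J. Poly_Mapping.keys (frag_of (c i, v i)))"
      unfolding f_def by (rule keys_sum)
    also have "\<dots> \<subseteq> S1 \<times> S2"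
      using J v by (auto simp: image_subset_iff)
    finally show "Poly_Mapping.keys f \<subseteq> S1 \<times> S2" .
    show "mult_eval f = 0"
      using J(4) by (simp add: f_def mult_eval_eq_lin_ext lin_ext_sum lin_ext_single)
  qed
  ultimately have "0 = \<Phi> f"
    by simp
  also have "\<Phi> f = (\<Sum>i\<in>J. c i * Poly_Mapping.lookup (co (v i)) j)"
    by (simp add: f_def \<Phi>_def lin_ext_sum lin_ext_single)
  also have "\<dots> = (\<Sum>i\<in>J. if i = j then c i else 0)"
    using J(2) by (intro sum.cong) (auto simp: co lookup_single)
  also have "\<dots> = c j"
    using J(1) j by simp
  finally show "c j = 0"
    by simp
qed

section \<open>Frobenius images of subrings and subfields\<close>

section \<open>Frobenius\<close>

lemma frobenius_diff:
  fixes x y :: "'a::comm_ring_1"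
  assumes "prime CHAR('a)"
  shows "(x - y) ^ CHAR('a) ^ n = x ^ CHAR('a) ^ n - y ^ CHAR('a) ^ n"
  using freshmans_dream' [OF assms refl, of "x - y" y n] by (simp add: algebra_simps)

lemma is_subring_pow_image:
  fixes A :: "'a::comm_ring_1 set"
  assumes "prime CHAR('a)" "is_subring A"
  shows "is_subring (pow_image (CHAR('a) ^ n) A)"
  unfolding is_subring_def
proof (intro conjI ballI)
  show "1 \<in> pow_image (CHAR('a) ^ n) A"
    using pow_imageI [OF is_subringD(1) [OF assms(2)], of "CHAR('a) ^ n"] by simp
next
  fix x y assume "x \<in> pow_image (CHAR('a) ^ n) A" "y \<in> pow_image (CHAR('a) ^ n) A"
  then obtain a b where ab: "a \<in> A" "b \<in> A" "x = a ^ CHAR('a) ^ n" "y = b ^ CHAR('a) ^ n"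
    unfolding pow_image_def by blast
  show "x - y \<in> pow_image (CHAR('a) ^ n) A"
    unfolding ab(3,4) frobenius_diff [OF assms(1), symmetric]
    by (intro pow_imageI is_subringD assms ab)
  show "x * y \<in> pow_image (CHAR('a) ^ n) A"
    unfolding ab(3,4) power_mult_distrib [symmetric]
    by (intro pow_imageI is_subringD assms ab)
qed

lemma is_subfield_pow_image:
  fixes A :: "'a::comm_ring_1 set"
  assumes "prime CHAR('a)" "is_subfield A"
  shows "is_subfield (pow_image (CHAR('a) ^ n) A)"
  unfolding is_subfield_def
proof (intro conjI ballI impI)
  show "is_subring (pow_image (CHAR('a) ^ n) A)"
    using assms by (simp add: is_subfield_def is_subring_pow_image)
next
  fix x assume "x \<in> pow_image (CHAR('a) ^ n) A" "x \<noteq> 0"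
  then obtain a where a: "a \<in> A" "x = a ^ CHAR('a) ^ n"
    by (auto simp: pow_image_def)
  moreover have "a \<noteq> 0"
    using a(2) \<open>x \<noteq> 0\<close> assms(1) by (auto simp: power_0_left prime_gt_0_nat)
  ultimately obtain b where "b \<in> A" "a * b = 1"
    using assms(2) by (auto simp: is_subfield_def)
  then show "\<exists>y\<in>pow_image (CHAR('a) ^ n) A. x * y = 1"
    using a(2) by (metis pow_imageI power_mult_distrib power_one)
qed

lemma adjoin_pow_image_mono:
  fixes k :: "'a::comm_ring_1 set"
  assumes "m dvd n"
  shows "adjoin (pow_image n UNIV) k \<subseteq> adjoin (pow_image m UNIV) k"
proof (rule adjoin_minimal [OF is_subring_adjoin])
  have "pow_image n (UNIV :: 'a set) \<subseteq> pow_image m UNIV"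
    unfolding pow_image_def
  proof (rule image_subsetI)
    fix x :: 'a
    obtain j where "n = j * m"
      using assms by (auto simp: dvd_def mult.commute)
    then show "x ^ n \<in> range (\<lambda>x. x ^ m)"
      by (simp add: power_mult)
  qed
  then show "pow_image n UNIV \<subseteq> adjoin (pow_image m UNIV) k"
    using adjoin_superset(1) by blast
qed (rule adjoin_superset)

section \<open>Arithmetic of exponents and spanning by monomials with exponents below
  \<open>q\<close>\<close>

section \<open>Monomials\<close>

text \<open>Allowing values \<open>u b\<close> in another monoid covers both the monomials
  themselves and their intended images in the power series ring.\<close>

definition mon_eval :: "('a \<Rightarrow> 'b::comm_monoid_mult) \<Rightarrow> ('a \<Rightarrow>\<^sub>0 nat) \<Rightarrow> 'b" where
  "mon_eval u \<alpha> = (\<Prod>b\<in>Poly_Mapping.keys \<alpha>. u b ^ Poly_Mapping.lookup \<alpha> b)"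

lemma monomial_eq_mon_eval: "monomial = mon_eval (\<lambda>b. b)"
  by (simp add: fun_eq_iff monomial_def mon_eval_def)

lemma mon_eval_superset:
  assumes "finite Z" "Poly_Mapping.keys \<alpha> \<subseteq> Z"
  shows "mon_eval u \<alpha> = (\<Prod>b\<in>Z. u b ^ Poly_Mapping.lookup \<alpha> b)"
  unfolding mon_eval_def
  by (rule prod.mono_neutral_left) (use assms in \<open>auto simp: in_keys_iff\<close>)

lemma mon_eval_zero [simp]: "mon_eval u 0 = 1"
  by (simp add: mon_eval_def)

lemma mon_eval_single: "mon_eval u (Poly_Mapping.single b n) = u b ^ n"
  by (simp add: mon_eval_def)

lemma mon_eval_add: "mon_eval u (\<alpha> + \<beta>) = mon_eval u \<alpha> * mon_eval u \<beta>"
proof -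
  let ?Z = "Poly_Mapping.keys \<alpha> \<union> Poly_Mapping.keys \<beta>"
  have "Poly_Mapping.keys (\<alpha> + \<beta>) \<subseteq> ?Z" by (rule keys_add)
  then show ?thesis
    by (simp add: mon_eval_superset [where Z = ?Z] lookup_add power_add prod.distrib)
qed

text \<open>Division with remainder by \<open>p\<close> in each exponent separately.\<close>

lemma mon_eval_div_mod:
  fixes u :: "'a \<Rightarrow> 'b::comm_semiring_1"
  shows "mon_eval u \<alpha> =
    mon_eval u (Poly_Mapping.map (\<lambda>n. n mod p) \<alpha>) * mon_eval u (Poly_Mapping.map (\<lambda>n. n div p) \<alpha>) ^ p"
proof -
  let ?Z = "Poly_Mapping.keys \<alpha>"
  have look: "Poly_Mapping.lookup (Poly_Mapping.map (\<lambda>n. n mod p) \<alpha>) b = Poly_Mapping.lookup \<alpha> b mod p"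
    "Poly_Mapping.lookup (Poly_Mapping.map (\<lambda>n. n div p) \<alpha>) b = Poly_Mapping.lookup \<alpha> b div p" for b
    by (auto simp: Poly_Mapping.map.rep_eq when_def)
  have keys: "Poly_Mapping.keys (Poly_Mapping.map (\<lambda>n. n mod p) \<alpha>) \<subseteq> ?Z"
    "Poly_Mapping.keys (Poly_Mapping.map (\<lambda>n. n div p) \<alpha>) \<subseteq> ?Z"
    by (auto simp: in_keys_iff look intro!: gr0I)
  show ?thesis
    unfolding mon_eval_superset [where Z = ?Z, OF finite_keys keys(1)]
      mon_eval_superset [where Z = ?Z, OF finite_keys keys(2)]
      mon_eval_superset [where Z = ?Z, OF finite_keys subset_refl] look prod_power_distrib
      prod.distrib [symmetric]
    by (rule prod.cong) (simp_all flip: power_add power_mult)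
qed

lemma zero_in_exponents: "q > 0 \<Longrightarrow> 0 \<in> exponents q B"
  by (simp add: exponents_def)

text \<open>The carry rule for multiplication by \<open>b\<close>: either every exponent stays below
  \<open>q\<close>, or that of \<open>b\<close> becomes exactly \<open>q\<close>, and resetting it
  to \<open>0\<close> splits off the factor \<open>b ^ q\<close>.\<close>

lemma exponents_add_single:
  assumes "q > 0" "b \<in> B" "\<alpha> \<in> exponents q B"
  shows "\<alpha> + Poly_Mapping.single b 1 \<in> exponents q B \<or>
    (\<exists>\<beta>\<in>exponents q B. \<alpha> + Poly_Mapping.single b 1 = \<beta> + Poly_Mapping.single b q)"
proof (cases "Poly_Mapping.lookup \<alpha> b + 1 < q")
  case True
  then have "\<alpha> + Poly_Mapping.single b 1 \<in> exponents q B"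
    using assms keys_add [of \<alpha> "Poly_Mapping.single b 1"]
    by (auto simp: exponents_def lookup_add lookup_single when_def)
  then show ?thesis ..
next
  case False
  then have "Poly_Mapping.lookup \<alpha> b + 1 = q"
    using assms(3) by (simp add: exponents_def) (metis Suc_lessI)
  then have "\<alpha> + Poly_Mapping.single b 1 = Poly_Mapping.update b 0 \<alpha> + Poly_Mapping.single b q"
    by (intro poly_mapping_eqI) (auto simp: lookup_add lookup_single lookup_update when_def)
  moreover have "Poly_Mapping.update b 0 \<alpha> \<in> exponents q B"
    using assms by (auto simp: exponents_def lookup_update keys_update)
  ultimately show ?thesis
    by blast
qed

text \<open>The elements whose multiplication maps the span into itself form a subring. It contains
  \<open>A\<close>, and it contains \<open>B\<close> because a carry only produces a scalar
  \<open>b ^ q\<close> in \<open>A\<close>. Applying such multiplications to \<open>1\<close>, which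
  lies in the span, gives the claim.\<close>

lemma monomials_span:
  assumes A: "is_subring A" and "q > 0" and pow: "\<And>b. b \<in> B \<Longrightarrow> b ^ q \<in> A"
  shows "adjoin A B \<subseteq> span_family A (exponents q B) monomial"
proof -
  let ?M = "span_family A (exponents q B) monomial"
  have "adjoin A B \<subseteq> {x. \<forall>y\<in>?M. x * y \<in> ?M}"
  proof (rule adjoin_minimal)
    show "is_subring {x. \<forall>y\<in>?M. x * y \<in> ?M}"
      by (simp add: is_subring_def left_diff_distrib span_family_diff [OF A] mult.assoc)
    show "A \<subseteq> {x. \<forall>y\<in>?M. x * y \<in> ?M}"
      by (auto intro: span_family_scale [OF A])
    show "B \<subseteq> {x. \<forall>y\<in>?M. x * y \<in> ?M}"
    proof (rule subsetI, rule CollectI, rule ballI)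
      fix b y assume b: "b \<in> B" and "y \<in> ?M"
      from this(2) show "b * y \<in> ?M"
      proof induction
        case zero
        show ?case by (simp add: span_family.zero)
      next
        case (step \<alpha> a y)
        have "b * monomial \<alpha> \<in> ?M"
          using exponents_add_single [OF \<open>q > 0\<close> b step(1)]
        proof (elim disjE bexE)
          assume "\<alpha> + Poly_Mapping.single b 1 \<in> exponents q B"
          from span_family_base [OF A this, of monomial] show ?thesis
            by (simp add: monomial_eq_mon_eval mon_eval_add mon_eval_single mult.commute)
        next
          fix \<beta> assume \<beta>: "\<beta> \<in> exponents q B"
            "\<alpha> + Poly_Mapping.single b 1 = \<beta> + Poly_Mapping.single b q"
          have "b * monomial \<alpha> = b ^ q * monomial \<beta>"
            using arg_cong [OF \<beta>(2), of monomial]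
            by (simp add: monomial_eq_mon_eval mon_eval_add mon_eval_single mult.commute)
          then show ?thesis
            using span_family_scale [OF A pow [OF b] span_family_base [OF A \<beta>(1)]] by simp
        qed
        then have "a * (b * monomial \<alpha>) + b * y \<in> ?M"
          using span_family_add [OF span_family_scale [OF A step(2)] step(4)] by simp
        then show ?case
          by (simp add: algebra_simps)
      qed
    qed
  qed
  moreover have "1 \<in> ?M"
    using span_family_base [OF A zero_in_exponents [OF \<open>q > 0\<close>], of monomial]
    by (simp add: monomial_eq_mon_eval)
  ultimately show ?thesis
    by force
qed

section \<open>Passage from a \<open>p\<close>-basis to a \<open>p^e\<close>-basis\<close>

section \<open>Bases of higher exponent\<close>

text \<open>When the indices are mapped by a possibly non-injective \<open>g\<close>, equal vectors
  must be collected first, so independence yields only the vanishing of each fibre sum. It serves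
  for the remainders and for the quotients of exponents.\<close>

lemma lin_indep_family_fibre_sums:
  assumes A: "is_subring A" and indep: "lin_indep_family A I v"
    and J: "finite J" "g ` J \<subseteq> I" "\<forall>j\<in>J. c j \<in> A" "(\<Sum>j\<in>J. c j * v (g j)) = 0"
  shows "(\<Sum>j\<in>{j\<in>J. g j = i}. c j) = 0"
proof (cases "i \<in> g ` J")
  case True
  have "(\<Sum>i\<in>g ` J. (\<Sum>j\<in>{j\<in>J. g j = i}. c j) * v i) = 0"
    using J(1,4) by (simp add: sum.image_gen [of J _ g] sum_distrib_right)
  moreover have "(\<Sum>j\<in>S. c j) \<in> A" if "S \<subseteq> J" for S
    using finite_subset [OF that J(1)] that J(3)
    by (induction S rule: finite_induct) (auto simp: is_subringD [OF A])
  then have "\<forall>i\<in>g ` J. (\<Sum>j\<in>{j\<in>J. g j = i}. c j) \<in> A"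
    by simp
  moreover have "finite (g ` J)"
    using J(1) by simp
  ultimately show ?thesis
    using lin_indep_familyD [OF indep _ J(2) _ _ True, of "\<lambda>i. \<Sum>j\<in>{j\<in>J. g j = i}. c j"]
    by blast
next
  case False
  then have "{j\<in>J. g j = i} = {}"
    by auto
  then show ?thesis
    by (simp only: sum.empty)
qed

text \<open>Again the multipliers of the span form a subring. The \<open>p ^ Suc e\<close>-th powers
  are \<open>p\<close>-th powers of elements \<open>r ^ p ^ e\<close>, hence scalars; for
  \<open>x\<close> in \<open>k\<close> and \<open>l\<close> in \<open>L\<close> the product
  \<open>x * l\<close> stays in \<open>k\<close>, which is spanned already over its own
  \<open>p\<close>-th powers.\<close>

lemma adjoin_pow_image_Suc_subset_span:
  fixes k :: "'a::comm_ring_1 set"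
  assumes p: "prime p" "CHAR('a) = p" and k: "is_subring k" and L: "L \<subseteq> k"
    and span: "k \<subseteq> span_family (pow_image p k) L (\<lambda>x. x)"
  shows "adjoin (pow_image (p ^ Suc e) UNIV) k \<subseteq>
    span_family (pow_image p (adjoin (pow_image (p ^ e) UNIV) k)) L (\<lambda>x. x)"
proof -
  let ?A = "adjoin (pow_image (p ^ e) UNIV) k"
  let ?M = "span_family (pow_image p ?A) L (\<lambda>x. x)"
  have ring: "is_subring (pow_image p ?A)"
    using is_subring_pow_image [of ?A 1] p by (simp add: is_subring_adjoin)
  have kM: "k \<subseteq> ?M"
    using span span_family_mono [of "pow_image p k" "pow_image p ?A" L "\<lambda>x. x"]
      adjoin_superset(2) [of k "pow_image (p ^ e) UNIV"] by (auto simp: pow_image_def)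
  have "adjoin (pow_image (p ^ Suc e) UNIV) k \<subseteq> {x. \<forall>y\<in>?M. x * y \<in> ?M}"
  proof (rule adjoin_minimal)
    show "is_subring {x. \<forall>y\<in>?M. x * y \<in> ?M}"
      by (simp add: is_subring_def left_diff_distrib span_family_diff [OF ring] mult.assoc)
    show "pow_image (p ^ Suc e) UNIV \<subseteq> {x. \<forall>y\<in>?M. x * y \<in> ?M}"
    proof (rule subsetI, rule CollectI, rule ballI)
      fix x y assume "x \<in> pow_image (p ^ Suc e) (UNIV :: 'a set)" and y: "y \<in> ?M"
      then obtain r where "x = (r ^ (p ^ e)) ^ p"
        by (auto simp: pow_image_def mult.commute power_mult [symmetric])
      moreover have "r ^ (p ^ e) \<in> ?A"
        using adjoin_superset(1) pow_imageI [of r UNIV] by blast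
      ultimately show "x * y \<in> ?M"
        using y by (auto intro: span_family_scale [OF ring] pow_imageI)
    qed
    show "k \<subseteq> {x. \<forall>y\<in>?M. x * y \<in> ?M}"
    proof (rule subsetI, rule CollectI, rule ballI)
      fix x y assume x: "x \<in> k" and "y \<in> ?M"
      from this(2) show "x * y \<in> ?M"
      proof induction
        case zero
        show ?case by (simp add: span_family.zero)
      next
        case (step l a y)
        have "x * l \<in> ?M"
          using x L step(1) kM is_subringD(4) [OF k] by blast
        then have "a * (x * l) + x * y \<in> ?M"
          using span_family_add [OF span_family_scale [OF ring step(2)] step(4)] by simp
        then show ?case
          by (simp add: algebra_simps)
      qed
    qed
  qed
  moreover have "1 \<in> ?M"
    using kM is_subringD(1) [OF k] by blast
  ultimately show ?thesis
    by force
qed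

lemma pe_independent_Suc:
  fixes k B :: "'a::comm_ring_1 set"
  assumes p: "prime p" "CHAR('a) = p" and red: "reduced_ring TYPE('a)" and k: "is_subfield k"
    and ld: "linearly_disjoint (pow_image p k) (pow_image p (UNIV :: 'a set)) k"
    and base: "pe_independent p 1 k B" and step: "pe_independent p e k B"
  shows "pe_independent p (Suc e) k B"
  unfolding pe_independent_def lin_indep_family_def
proof (intro allI impI ballI, elim conjE)
  let ?A = "\<lambda>e. adjoin (pow_image (p ^ e) UNIV) k"
  fix J c \<alpha>0
  assume J: "finite J" "J \<subseteq> exponents (p ^ Suc e) B" "\<forall>\<alpha>\<in>J. c \<alpha> \<in> ?A (Suc e)"
    "(\<Sum>\<alpha>\<in>J. c \<alpha> * monomial \<alpha>) = 0" and \<alpha>0: "\<alpha>0 \<in> J"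
  \<comment> \<open>Remainder and quotient of all exponents modulo \<open>p\<close>; together they
    determine the exponent.\<close>
  define md :: "('a \<Rightarrow>\<^sub>0 nat) \<Rightarrow> _" where "md = Poly_Mapping.map (\<lambda>n. n mod p)"
  define dv :: "('a \<Rightarrow>\<^sub>0 nat) \<Rightarrow> _" where "dv = Poly_Mapping.map (\<lambda>n. n div p)"
  have p0: "p > 0"
    using p(1) by (rule prime_gt_0_nat)
  have look: "Poly_Mapping.lookup (md \<alpha>) b = Poly_Mapping.lookup \<alpha> b mod p"
    "Poly_Mapping.lookup (dv \<alpha>) b = Poly_Mapping.lookup \<alpha> b div p" for \<alpha> b
    by (auto simp: md_def dv_def Poly_Mapping.map.rep_eq when_def)
  have keys: "Poly_Mapping.keys (md \<alpha>) \<subseteq> Poly_Mapping.keys \<alpha>"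
    "Poly_Mapping.keys (dv \<alpha>) \<subseteq> Poly_Mapping.keys \<alpha>" for \<alpha>
    by (auto simp: in_keys_iff look intro!: gr0I)
  have md: "md \<alpha> \<in> exponents (p ^ 1) B" and dv: "dv \<alpha> \<in> exponents (p ^ e) B" if "\<alpha> \<in> J" for \<alpha>
  proof -
    have "Poly_Mapping.keys \<alpha> \<subseteq> B" "Poly_Mapping.lookup \<alpha> b < p ^ e * p" for b
      using that J(2) by (auto simp: exponents_def mult.commute)
    then show "md \<alpha> \<in> exponents (p ^ 1) B" "dv \<alpha> \<in> exponents (p ^ e) B"
      using keys [of \<alpha>] p0 by (auto simp: exponents_def look less_mult_imp_div_less)
  qed
  have split: "monomial \<alpha> = monomial (md \<alpha>) * monomial (dv \<alpha>) ^ p" for \<alpha> :: "'a \<Rightarrow>\<^sub>0 nat"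
    unfolding monomial_eq_mon_eval md_def dv_def by (rule mon_eval_div_mod)
  \<comment> \<open>The terms with the same remainder as the chosen \<open>\<alpha>0\<close>. On
    \<open>G\<close> the quotient \<open>dv\<close> is injective.\<close>
  define G where "G = {\<alpha>\<in>J. md \<alpha> = md \<alpha>0}"
  have G: "finite G" "G \<subseteq> J" "\<alpha>0 \<in> G"
    using J(1) \<alpha>0 by (auto simp: G_def)
  have inj: "\<alpha> = \<beta>" if "\<alpha> \<in> G" "\<beta> \<in> G" "dv \<alpha> = dv \<beta>" for \<alpha> \<beta>
  proof (rule poly_mapping_eqI)
    fix b
    have "md \<alpha> = md \<beta>"
      using that by (simp add: G_def)
    then show "Poly_Mapping.lookup \<alpha> b = Poly_Mapping.lookup \<beta> b"
      using that(3) look [of _ b] by (metis div_mult_mod_eq)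
  qed

  \<comment> \<open>The factors \<open>monomial (dv \<alpha>) ^ p\<close> are \<open>p\<close>-th
    powers and so count as scalars at level 1, as does \<open>c \<alpha>\<close>;
    \<open>p\<close>-independence then acts on the remainders alone.\<close>
  have "(\<Sum>\<alpha>\<in>{\<alpha>\<in>J. md \<alpha> = md \<alpha>0}. c \<alpha> * monomial (dv \<alpha>) ^ p) = 0"
  proof (rule lin_indep_family_fibre_sums)
    show "is_subring (?A 1)"
      by (rule is_subring_adjoin)
    show "lin_indep_family (?A 1) (exponents (p ^ 1) B) monomial"
      using base by (simp add: pe_independent_def)
    show "md ` J \<subseteq> exponents (p ^ 1) B"
      using md by blast
    show "(\<Sum>\<alpha>\<in>J. c \<alpha> * monomial (dv \<alpha>) ^ p * monomial (md \<alpha>)) = 0"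
      using J(4) by (simp add: split [symmetric] mult.assoc mult.commute [of "_ ^ p"])
    show "\<forall>\<alpha>\<in>J. c \<alpha> * monomial (dv \<alpha>) ^ p \<in> ?A 1"
    proof
      fix \<alpha> assume "\<alpha> \<in> J"
      then have "c \<alpha> \<in> ?A 1"
        using J(3) adjoin_pow_image_mono [of "p ^ 1" "p ^ Suc e" k] by auto
      moreover have "monomial (dv \<alpha>) ^ p \<in> ?A 1"
        using adjoin_superset(1) [of "pow_image p UNIV" k] pow_imageI [of "monomial (dv \<alpha>)" UNIV p]
        by auto
      ultimately show "c \<alpha> * monomial (dv \<alpha>) ^ p \<in> ?A 1"
        by (rule is_subringD(4) [OF is_subring_adjoin])
    qed
  qed (rule J(1))
  then have vanish: "(\<Sum>\<alpha>\<in>G. c \<alpha> * monomial (dv \<alpha>) ^ p) = 0"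
    by (simp add: G_def)

  have ring: "is_subring k" "is_subring (pow_image p k)" "is_subring (pow_image p (?A e))"
    using k is_subring_pow_image [of k 1] is_subring_pow_image [of "?A e" 1] p
    by (simp_all add: is_subfield_def is_subring_adjoin)
  have "is_subfield (pow_image p k)"
    using k is_subfield_pow_image [of k 1] p by simp
  then obtain L where L: "L \<subseteq> k" "lin_indep_family (pow_image p k) L (\<lambda>x. x)"
    "k \<subseteq> span_family (pow_image p k) L (\<lambda>x. x)"
    by (rule subfield_basis)
  \<comment> \<open>The only use of linear disjointness: a basis of \<open>k\<close> over its
    \<open>p\<close>-th powers stays independent over all \<open>p\<close>-th powers of the
    ring.\<close>
  have indep: "lin_indep_family (pow_image p (UNIV :: 'a set)) L (\<lambda>x. x)"
    using linearly_disjoint_imp_lin_indep [OF ld ring(2) L(2) _ L(3)] L(1) by simp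

  have "\<exists>f\<in>combs (pow_image p (?A e)) L. c \<alpha> = lin_ext (\<lambda>a. a) (\<lambda>x. x) f" if "\<alpha> \<in> G" for \<alpha>
    using span_family_combs [OF ring(3)] adjoin_pow_image_Suc_subset_span [OF p ring(1) L(1,3), of e]
      J(3) G(2) that by blast
  then obtain f where f: "\<And>\<alpha>. \<alpha> \<in> G \<Longrightarrow> f \<alpha> \<in> combs (pow_image p (?A e)) L"
    "\<And>\<alpha>. \<alpha> \<in> G \<Longrightarrow> c \<alpha> = lin_ext (\<lambda>a. a) (\<lambda>x. x) (f \<alpha>)"
    by metis
  have "\<forall>\<alpha> l. \<exists>s. \<alpha> \<in> G \<longrightarrow> s \<in> ?A e \<and> Poly_Mapping.lookup (f \<alpha>) l = s ^ p"
    using f(1) by (auto simp: combs_def pow_image_def image_iff) metis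
  then obtain s where s: "\<And>\<alpha> l. \<alpha> \<in> G \<Longrightarrow> s \<alpha> l \<in> ?A e"
    "\<And>\<alpha> l. \<alpha> \<in> G \<Longrightarrow> Poly_Mapping.lookup (f \<alpha>) l = s \<alpha> l ^ p"
    by metis
  \<comment> \<open>A common finite support, so that all \<open>c \<alpha>\<close> are sums over the
    same elements of \<open>L\<close> and the two summations can be exchanged.\<close>
  define Z where "Z = (\<Union>\<alpha>\<in>G. Poly_Mapping.keys (f \<alpha>))"
  have Z: "finite Z" "Z \<subseteq> L"
    using G(1) f(1) by (auto simp: Z_def combs_def)
  have c: "c \<alpha> = (\<Sum>l\<in>Z. s \<alpha> l ^ p * l)" if "\<alpha> \<in> G" for \<alpha>
    using f(2) [OF that] lin_ext_superset [of "\<lambda>a. a" Z "f \<alpha>" "\<lambda>x. x"] Z(1) s(2) [OF that] that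
    by (auto simp: Z_def)

  have "0 = (\<Sum>\<alpha>\<in>G. \<Sum>l\<in>Z. (s \<alpha> l * monomial (dv \<alpha>)) ^ p * l)"
    using vanish by (simp add: c sum_distrib_right sum_distrib_left power_mult_distrib mult_ac)
  also have "\<dots> = (\<Sum>l\<in>Z. \<Sum>\<alpha>\<in>G. (s \<alpha> l * monomial (dv \<alpha>)) ^ p * l)"
    by (rule sum.swap)
  \<comment> \<open>Additivity of Frobenius gathers the coefficient of each \<open>l\<close> into a
    single \<open>p\<close>-th power.\<close>
  also have "\<dots> = (\<Sum>l\<in>Z. (\<Sum>\<alpha>\<in>G. s \<alpha> l * monomial (dv \<alpha>)) ^ p * l)"
    using p by (simp add: freshmans_dream_sum sum_distrib_right)
  finally have "(\<Sum>l\<in>Z. (\<Sum>\<alpha>\<in>G. s \<alpha> l * monomial (dv \<alpha>)) ^ p * l) = 0"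
    by (rule sym)
  then have "(\<Sum>\<alpha>\<in>G. s \<alpha> l * monomial (dv \<alpha>)) ^ p = 0" if "l \<in> Z" for l
    using lin_indep_familyD [OF indep Z _ _ that, where c = "\<lambda>l. (\<Sum>\<alpha>\<in>G. s \<alpha> l * monomial (dv \<alpha>)) ^ p"]
    by (simp only: pow_imageI UNIV_I)
  \<comment> \<open>The ring is reduced, so the \<open>p\<close>-th root of zero is zero. What
    remains is a relation over the scalars of level \<open>e\<close>.\<close>
  then have s_vanish: "(\<Sum>\<alpha>\<in>G. s \<alpha> l * monomial (dv \<alpha>)) = 0" if "l \<in> Z" for l
    using red that unfolding reduced_ring_def by blast
  have "s \<alpha>0 l = 0" if "l \<in> Z" for l
  proof -
    \<comment> \<open>Independence at level \<open>e\<close> kills fibre sums of \<open>dv\<close>;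
      by injectivity on \<open>G\<close> the fibre of \<open>\<alpha>0\<close> is a single
      point.\<close>
    have "(\<Sum>\<alpha>\<in>{\<alpha>\<in>G. dv \<alpha> = dv \<alpha>0}. s \<alpha> l) = 0"
      using step G dv s(1) s_vanish [OF that] unfolding pe_independent_def
      by (intro lin_indep_family_fibre_sums [OF is_subring_adjoin, where v = monomial]) auto
    moreover have "{\<alpha>\<in>G. dv \<alpha> = dv \<alpha>0} = {\<alpha>0}"
      using inj G(3) by blast
    ultimately show ?thesis
      by simp
  qed
  then show "c \<alpha>0 = 0"
    using p0 by (simp add: c [OF G(3)] power_0_left)
qed

text \<open>Independence climbs by \<open>pe_independent_Suc\<close>. For generation, Frobenius
  carries the generators of level \<open>e\<close> into the ring generated at level
  \<open>Suc e\<close>. So that ring contains all \<open>p\<close>-th powers, and then everything,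
  because \<open>B\<close> generates at level 1.\<close>

lemma p_basis_imp_pe_basis:
  fixes k B :: "'a::comm_ring_1 set"
  assumes p: "prime p" "CHAR('a) = p" and red: "reduced_ring TYPE('a)" and k: "is_subfield k"
    and ld: "linearly_disjoint (pow_image p k) (pow_image p (UNIV :: 'a set)) k"
    and B: "p_basis p k B"
  shows "pe_basis p e k B"
proof (induction e)
  case 0
  \<comment> \<open>Starting at \<open>e = 0\<close> makes the base case trivial: all elements are
    scalars and the only monomial is \<open>1\<close>.\<close>
  have "exponents 1 B = {0}"
    by (auto simp: exponents_def intro: poly_mapping_eqI)
  then have "pe_independent p 0 k B"
    unfolding pe_independent_def lin_indep_family_def
    by (auto simp: monomial_def subset_singleton_iff simp del: pow_image_1)
  moreover have "adjoin (adjoin (pow_image (p ^ 0) UNIV) k) B = UNIV"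
    using adjoin_superset(1) [of "pow_image 1 UNIV" k]
      adjoin_superset(1) [of "adjoin (pow_image 1 UNIV) k" B] by simp blast
  ultimately show ?case
    by (simp add: pe_basis_def)
next
  case (Suc e)
  let ?A = "\<lambda>e. adjoin (pow_image (p ^ e) UNIV) k"
  let ?R = "adjoin (?A (Suc e)) B"
  have k_ring: "k \<subseteq> ?R" and pow: "pow_image (p ^ Suc e) UNIV \<subseteq> ?R"
    using adjoin_superset(2) [of k "pow_image (p ^ Suc e) UNIV"]
      adjoin_superset(1) [of "pow_image (p ^ Suc e) UNIV" k]
      adjoin_superset(1) [of "?A (Suc e)" B]
    by (meson subset_trans)+
  have ring: "is_subring {x. x ^ p \<in> ?R}"
    using p frobenius_diff [where 'a = 'a and n = 1]
    by (auto simp: is_subring_def power_mult_distrib is_subringD [OF is_subring_adjoin])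
  have "adjoin (?A e) B \<subseteq> {x. x ^ p \<in> ?R}"
  proof (intro adjoin_minimal ring)
    have "(r ^ p ^ e) ^ p \<in> ?R" for r
      using pow pow_imageI [of r UNIV "p ^ Suc e"] by (auto simp: mult.commute simp flip: power_mult)
    then show "pow_image (p ^ e) UNIV \<subseteq> {x. x ^ p \<in> ?R}"
      by (auto simp: pow_image_def)
    show "k \<subseteq> {x. x ^ p \<in> ?R}" "B \<subseteq> {x. x ^ p \<in> ?R}"
      using k_ring adjoin_superset(2) [of B] is_subringD(7) [OF is_subring_adjoin] by blast+
  qed
  then have "pow_image p UNIV \<subseteq> ?R"
    using Suc by (auto simp: pe_basis_def pow_image_def)
  then have "adjoin (adjoin (pow_image (p ^ 1) UNIV) k) B \<subseteq> ?R"
    using k_ring adjoin_superset(2) [of B "?A (Suc e)"]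
    by (intro adjoin_minimal is_subring_adjoin) simp_all
  then have "?R = UNIV"
    using B by (auto simp: p_basis_def pe_basis_def)
  then show ?case
    using pe_independent_Suc [OF p red k ld] B Suc by (simp add: p_basis_def pe_basis_def)
qed

section \<open>Existence and uniqueness of homomorphisms modulo a power of
  \<open>fps_X\<close>\<close>

section \<open>Truncated homomorphisms into power series\<close>

text \<open>Congruence modulo the ideal generated by \<open>fps_X ^ q\<close>.\<close>

definition fps_cong :: "nat \<Rightarrow> 'a::comm_ring_1 fps \<Rightarrow> 'a fps \<Rightarrow> bool" where
  "fps_cong q f g \<longleftrightarrow> (\<forall>n<q. fps_nth f n = fps_nth g n)"

lemma fps_cong_refl [simp]: "fps_cong q f f"
  by (simp add: fps_cong_def)

lemma fps_cong_sym: "fps_cong q f g \<Longrightarrow> fps_cong q g f"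
  by (simp add: fps_cong_def)

lemma fps_cong_trans [trans]: "fps_cong q f g \<Longrightarrow> fps_cong q g h \<Longrightarrow> fps_cong q f h"
  by (simp add: fps_cong_def)

lemma fps_cong_mono: "fps_cong q' f g \<Longrightarrow> q \<le> q' \<Longrightarrow> fps_cong q f g"
  by (simp add: fps_cong_def)

lemma fps_cong_add: "fps_cong q f g \<Longrightarrow> fps_cong q f' g' \<Longrightarrow> fps_cong q (f + f') (g + g')"
  by (simp add: fps_cong_def)

lemma fps_cong_diff: "fps_cong q f g \<Longrightarrow> fps_cong q f' g' \<Longrightarrow> fps_cong q (f - f') (g - g')"
  by (simp add: fps_cong_def)

lemma fps_cong_mult:
  assumes "fps_cong q f g" "fps_cong q f' g'"
  shows "fps_cong q (f * f') (g * g')"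
  using assms by (auto simp: fps_cong_def fps_mult_nth intro!: sum.cong)

text \<open>Write \<open>f\<close> as its constant term plus a multiple of \<open>fps_X\<close>; the
  \<open>p ^ e\<close>-th power acts on the two summands separately and makes the second divisible
  by \<open>fps_X ^ p ^ e\<close>.\<close>

lemma fps_cong_frobenius:
  fixes f :: "'a::comm_ring_1 fps"
  assumes p: "prime p" "CHAR('a) = p"
  shows "fps_cong (p ^ e) (f ^ p ^ e) (fps_const (fps_nth f 0 ^ p ^ e))"
proof -
  have "f = fps_const (fps_nth f 0) + fps_X * fps_shift 1 f"
    by (intro fps_ext) (simp add: fps_shift_def)
  then have "f ^ p ^ e = fps_const (fps_nth f 0) ^ p ^ e + (fps_X * fps_shift 1 f) ^ p ^ e"
    using freshmans_dream' [of "p ^ e" e "fps_const (fps_nth f 0)" "fps_X * fps_shift 1 f"] p by simp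
  then show ?thesis
    by (simp add: fps_cong_def power_mult_distrib fps_X_power_mult_nth fps_const_power)
qed

text \<open>Additivity and \<open>A\<close>-linearity are exact, since a map defined on a basis has
  them; only multiplicativity is truncated.\<close>

definition truncated_hom :: "nat \<Rightarrow> 'a::comm_ring_1 set \<Rightarrow> ('a \<Rightarrow> 'a fps) \<Rightarrow> bool" where
  "truncated_hom q A \<phi> \<longleftrightarrow>
     (\<forall>x y. \<phi> (x + y) = \<phi> x + \<phi> y) \<and>
     (\<forall>a\<in>A. \<forall>x. \<phi> (a * x) = fps_const a * \<phi> x) \<and>
     \<phi> 1 = 1 \<and> (\<forall>x. fps_nth (\<phi> x) 0 = x) \<and>
     (\<forall>x y. fps_cong q (\<phi> (x * y)) (\<phi> x * \<phi> y))"

lemma truncated_homD: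
  assumes "truncated_hom q A \<phi>"
  shows "\<phi> (x + y) = \<phi> x + \<phi> y" "\<phi> (x - y) = \<phi> x - \<phi> y"
    "a \<in> A \<Longrightarrow> \<phi> (a * x) = fps_const a * \<phi> x" "a \<in> A \<Longrightarrow> \<phi> a = fps_const a"
    "\<phi> 1 = 1" "fps_nth (\<phi> x) 0 = x"
    "fps_cong q (\<phi> (x * y)) (\<phi> x * \<phi> y)" "fps_cong q (\<phi> (x ^ n)) (\<phi> x ^ n)"
proof -
  show add: "\<phi> (x + y) = \<phi> x + \<phi> y" for x y
    using assms by (simp add: truncated_hom_def)
  show "\<phi> (x - y) = \<phi> x - \<phi> y"
    using add [of "x - y" y] by simp
  show scale: "\<phi> (a * x) = fps_const a * \<phi> x" if "a \<in> A" for a x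
    using assms that by (simp add: truncated_hom_def)
  show one: "\<phi> 1 = 1"
    using assms by (simp add: truncated_hom_def)
  show "\<phi> a = fps_const a" if "a \<in> A"
    using scale [OF that, of 1] one by simp
  show "fps_nth (\<phi> x) 0 = x"
    using assms by (simp add: truncated_hom_def)
  show mult: "fps_cong q (\<phi> (x * y)) (\<phi> x * \<phi> y)" for x y
    using assms by (simp add: truncated_hom_def)
  show "fps_cong q (\<phi> (x ^ n)) (\<phi> x ^ n)"
  proof (induction n)
    case (Suc n)
    from fps_cong_mult [OF fps_cong_refl this] mult show ?case
      unfolding power_Suc by (rule fps_cong_trans [rotated])
  qed (simp add: one)
qed

text \<open>The map is prescribed on the basis of reduced monomials. Multiplicativity can fail only
  at a carry, where \<open>b ^ q\<close> is a scalar while the image side has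
  \<open>w b ^ q\<close>. These agree to the required order because \<open>w b\<close> has constant
  term \<open>b\<close>.\<close>

lemma truncated_hom_exists:
  fixes k B :: "'a::comm_ring_1 set"
  assumes p: "prime p" "CHAR('a) = p" and basis: "pe_basis p e k B"
    and w: "\<And>b. b \<in> B \<Longrightarrow> fps_nth (w b) 0 = b"
  obtains \<phi> where "truncated_hom (p ^ e) (adjoin (pow_image (p ^ e) UNIV) k) \<phi>"
    "\<And>b. b \<in> B \<Longrightarrow> fps_cong (p ^ e) (\<phi> b) (w b)"
proof -
  define q A where "q = p ^ e" and "A = adjoin (pow_image q (UNIV :: 'a set)) k"
  let ?I = "exponents q B"
  have q: "q > 0"
    using p(1) by (simp add: q_def prime_gt_0_nat)
  have A: "is_subring A"
    unfolding A_def by (rule is_subring_adjoin)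
  have pow: "b ^ q \<in> A" for b
    unfolding A_def using adjoin_superset(1) pow_imageI [of b UNIV] by blast
  have indep: "lin_indep_family A ?I monomial" and gen: "adjoin A B = UNIV"
    using basis by (simp_all add: pe_basis_def pe_independent_def A_def q_def)
  have span: "x \<in> span_family A ?I monomial" for x
    using monomials_span [OF A q pow] gen by blast
  obtain \<phi> where add: "\<And>x y. \<phi> (x + y) = \<phi> x + \<phi> y"
    and scale: "\<And>a x. a \<in> A \<Longrightarrow> \<phi> (a * x) = fps_const a * \<phi> x"
    and mon: "\<And>\<alpha>. \<alpha> \<in> ?I \<Longrightarrow> \<phi> (monomial \<alpha>) = mon_eval w \<alpha>"
    using linear_extension [OF A indep, of fps_const "mon_eval w"] span
    by (simp flip: fps_const_add fps_const_mult) metis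
  have diff: "\<phi> (x - y) = \<phi> x - \<phi> y" for x y
    using add [of "x - y" y] by simp
  have zero: "\<phi> 0 = 0"
    using diff [of 0 0] by simp
  have one: "\<phi> 1 = 1"
    using mon [OF zero_in_exponents [OF q]] by (simp add: monomial_eq_mon_eval)
  have const: "\<phi> a = fps_const a" if "a \<in> A" for a
    using scale [OF that, of 1] one by simp
  have w_pow: "fps_cong q (w b ^ q) (fps_const (b ^ q))" if "b \<in> B" for b
    using fps_cong_frobenius [OF p, of e "w b"] w [OF that] by (simp add: q_def)

  \<comment> \<open>Multiplicativity is tested first with one factor in \<open>B\<close>, by
    induction on the other factor as a combination of monomials.\<close>
  have mult_w: "fps_cong q (\<phi> (b * y)) (w b * \<phi> y)" if b: "b \<in> B" for b y
    using span [of y]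
  proof induction
    case zero
    show ?case by (simp add: \<open>\<phi> 0 = 0\<close>)
  next
    case (step \<alpha> a y)
    have b_mon: "b * monomial \<alpha> = monomial (\<alpha> + Poly_Mapping.single b 1)"
      and w_mon: "w b * mon_eval w \<alpha> = mon_eval w (\<alpha> + Poly_Mapping.single b 1)"
      by (simp_all add: monomial_eq_mon_eval mon_eval_add mon_eval_single mult.commute)
    have "fps_cong q (\<phi> (b * monomial \<alpha>)) (w b * \<phi> (monomial \<alpha>))"
      using exponents_add_single [OF q b step(1)]
    proof (elim disjE bexE)
      assume "\<alpha> + Poly_Mapping.single b 1 \<in> ?I"
      then show ?thesis
        unfolding b_mon mon [OF step(1)] w_mon by (simp add: mon)
    next
      fix \<beta> assume \<beta>: "\<beta> \<in> ?I" "\<alpha> + Poly_Mapping.single b 1 = \<beta> + Poly_Mapping.single b q"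
      have "\<phi> (b * monomial \<alpha>) = \<phi> (b ^ q * monomial \<beta>)"
        unfolding b_mon \<beta>(2)
        by (simp add: monomial_eq_mon_eval mon_eval_add mon_eval_single mult.commute)
      also have "\<dots> = fps_const (b ^ q) * mon_eval w \<beta>"
        using scale [OF pow] mon [OF \<beta>(1)] by simp
      finally have lhs: "\<phi> (b * monomial \<alpha>) = fps_const (b ^ q) * mon_eval w \<beta>" .
      have rhs: "w b * \<phi> (monomial \<alpha>) = w b ^ q * mon_eval w \<beta>"
        unfolding mon [OF step(1)] w_mon \<beta>(2)
        by (simp add: mon_eval_add mon_eval_single mult.commute)
      show ?thesis
        unfolding lhs rhs by (intro fps_cong_mult fps_cong_refl fps_cong_sym [OF w_pow [OF b]])
    qed
    then have "fps_cong q (fps_const a * \<phi> (b * monomial \<alpha>) + \<phi> (b * y))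
        (fps_const a * (w b * \<phi> (monomial \<alpha>)) + w b * \<phi> y)"
      using step by (intro fps_cong_add fps_cong_mult) simp_all
    moreover have "\<phi> (b * (a * monomial \<alpha> + y)) = fps_const a * \<phi> (b * monomial \<alpha>) + \<phi> (b * y)"
      by (simp add: distrib_left add mult.left_commute [of b a] scale [OF step(2)])
    moreover have "w b * \<phi> (a * monomial \<alpha> + y) = fps_const a * (w b * \<phi> (monomial \<alpha>)) + w b * \<phi> y"
      by (simp add: distrib_left add scale [OF step(2)] mult.left_commute)
    ultimately show ?case
      by simp
  qed
  \<comment> \<open>Only a congruence: for \<open>e = 0\<close> every element is a scalar, so
    \<open>\<phi> b\<close> is constant although \<open>w b\<close> need not be.\<close>
  have \<phi>_w: "fps_cong q (\<phi> b) (w b)" if "b \<in> B" for b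
    using mult_w [OF that, of 1] one by simp

  \<comment> \<open>The factors \<open>x\<close> that are multiplicative against every
    \<open>y\<close> form a subring containing \<open>A\<close> and \<open>B\<close>.\<close>
  have "adjoin A B \<subseteq> {x. \<forall>y. fps_cong q (\<phi> (x * y)) (\<phi> x * \<phi> y)}"
  proof (rule adjoin_minimal)
    show "is_subring {x. \<forall>y. fps_cong q (\<phi> (x * y)) (\<phi> x * \<phi> y)}"
      unfolding is_subring_def
    proof (intro conjI ballI; clarsimp simp: one)
      fix x x' y
      assume "\<forall>y. fps_cong q (\<phi> (x * y)) (\<phi> x * \<phi> y)" "\<forall>y. fps_cong q (\<phi> (x' * y)) (\<phi> x' * \<phi> y)"
      then show "fps_cong q (\<phi> ((x - x') * y)) (\<phi> (x - x') * \<phi> y)"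
        by (simp add: left_diff_distrib diff fps_cong_diff)
    next
      fix x x' y
      assume x: "\<forall>y. fps_cong q (\<phi> (x * y)) (\<phi> x * \<phi> y)" "\<forall>y. fps_cong q (\<phi> (x' * y)) (\<phi> x' * \<phi> y)"
      have "fps_cong q (\<phi> (x * x' * y)) (\<phi> x * \<phi> (x' * y))"
        using x(1) by (simp add: mult.assoc)
      also have "fps_cong q (\<phi> x * \<phi> (x' * y)) (\<phi> x * \<phi> x' * \<phi> y)"
        using x(2) by (simp add: mult.assoc fps_cong_mult)
      also have "fps_cong q (\<phi> x * \<phi> x' * \<phi> y) (\<phi> (x * x') * \<phi> y)"
        using x(1) by (intro fps_cong_mult fps_cong_sym [of q "\<phi> (x * x')"]) simp_all
      finally show "fps_cong q (\<phi> (x * x' * y)) (\<phi> (x * x') * \<phi> y)" .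
    qed
    show "A \<subseteq> {x. \<forall>y. fps_cong q (\<phi> (x * y)) (\<phi> x * \<phi> y)}"
      by (auto simp: scale const)
    show "B \<subseteq> {x. \<forall>y. fps_cong q (\<phi> (x * y)) (\<phi> x * \<phi> y)}"
    proof (rule subsetI, rule CollectI, rule allI)
      fix b y assume b: "b \<in> B"
      note mult_w [OF b, of y]
      also have "fps_cong q (w b * \<phi> y) (\<phi> b * \<phi> y)"
        by (intro fps_cong_mult fps_cong_refl fps_cong_sym [OF \<phi>_w [OF b]])
      finally show "fps_cong q (\<phi> (b * y)) (\<phi> b * \<phi> y)" .
    qed
  qed
  then have mult: "fps_cong q (\<phi> (x * y)) (\<phi> x * \<phi> y)" for x y
    using gen by blast
  then have mult0: "fps_nth (\<phi> (x * y)) 0 = fps_nth (\<phi> x) 0 * fps_nth (\<phi> y) 0" for x y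
    using q by (simp add: fps_cong_def)
  have "adjoin A B \<subseteq> {x. fps_nth (\<phi> x) 0 = x}"
  proof (rule adjoin_minimal)
    show "is_subring {x. fps_nth (\<phi> x) 0 = x}"
      by (simp add: is_subring_def one diff mult0)
    show "A \<subseteq> {x. fps_nth (\<phi> x) 0 = x}"
      by (auto simp: const)
    show "B \<subseteq> {x. fps_nth (\<phi> x) 0 = x}"
      using \<phi>_w w q by (auto simp: fps_cong_def)
  qed
  then have "fps_nth (\<phi> x) 0 = x" for x
    using gen by blast
  with add scale one mult have "truncated_hom q A \<phi>"
    by (simp add: truncated_hom_def)
  with \<phi>_w that show thesis
    by (simp add: q_def A_def)
qed

text \<open>The elements on which the two maps agree to order \<open>p ^ e\<close> form a subring
  containing \<open>k\<close> and \<open>B\<close>. For \<open>p ^ e\<close>-th powers,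
  \<open>\<phi>\<close> is linear over them, whereas \<open>\<psi>\<close>, possibly of a higher
  level, sends them to \<open>p ^ e\<close>-th powers of series, which are constant to that
  order.\<close>

lemma truncated_hom_unique:
  fixes k B :: "'a::comm_ring_1 set"
  assumes p: "prime p" "CHAR('a) = p" and gen: "adjoin (adjoin (pow_image (p ^ e) UNIV) k) B = UNIV"
    and \<phi>: "truncated_hom (p ^ e) (adjoin (pow_image (p ^ e) UNIV) k) \<phi>"
    and \<psi>: "truncated_hom q' A' \<psi>" and "p ^ e \<le> q'" "k \<subseteq> A'"
    and B: "\<And>b. b \<in> B \<Longrightarrow> fps_cong (p ^ e) (\<phi> b) (\<psi> b)"
  shows "fps_cong (p ^ e) (\<phi> x) (\<psi> x)"
proof -
  define q A where "q = p ^ e" and "A = adjoin (pow_image q (UNIV :: 'a set)) k"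
  note \<phi> = truncated_homD [OF \<phi>, folded q_def, folded A_def]
  note \<psi> = truncated_homD [OF \<psi>]
  have \<psi>_mult: "fps_cong q (\<psi> (x * y)) (\<psi> x * \<psi> y)" for x y
    using fps_cong_mono [OF \<psi>(7)] \<open>p ^ e \<le> q'\<close> by (simp add: q_def)
  let ?E = "{x. fps_cong q (\<phi> x) (\<psi> x)}"
  have ring: "is_subring ?E"
    unfolding is_subring_def
  proof (intro conjI ballI)
    show "1 \<in> ?E"
      by (simp add: \<phi> \<psi>)
  next
    fix x y assume x: "x \<in> ?E" and y: "y \<in> ?E"
    then show "x - y \<in> ?E"
      by (simp add: \<phi>(2) \<psi>(2) fps_cong_diff)
    note \<phi>(7) [of x y]
    also have "fps_cong q (\<phi> x * \<phi> y) (\<psi> x * \<psi> y)"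
      using x y by (simp add: fps_cong_mult)
    also note fps_cong_sym [OF \<psi>_mult]
    finally show "x * y \<in> ?E"
      by simp
  qed
  have "A \<subseteq> ?E"
    unfolding A_def
  proof (rule adjoin_minimal [OF ring])
    show "pow_image q UNIV \<subseteq> ?E"
    proof
      fix x assume "x \<in> pow_image q (UNIV :: 'a set)"
      then obtain r where x: "x = r ^ q"
        by (auto simp: pow_image_def)
      have "x \<in> A"
        unfolding x A_def using adjoin_superset(1) pow_imageI [of r UNIV] by blast
      then have "\<phi> x = fps_const x"
        by (rule \<phi>(4))
      moreover have "fps_cong q (\<psi> (r ^ q)) (\<psi> r ^ q)"
        using fps_cong_mono [OF \<psi>(8)] \<open>p ^ e \<le> q'\<close> by (simp add: q_def)
      moreover have "fps_cong q (\<psi> r ^ q) (fps_const (r ^ q))"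
        using fps_cong_frobenius [OF p, of e "\<psi> r"] by (simp add: q_def \<psi>(6))
      ultimately show "x \<in> ?E"
        unfolding x using fps_cong_trans fps_cong_sym by fastforce
    qed
    show "k \<subseteq> ?E"
    proof
      fix c assume "c \<in> k"
      then have "c \<in> A" "c \<in> A'"
        using adjoin_superset(2) [of k] \<open>k \<subseteq> A'\<close> by (auto simp: A_def)
      then show "c \<in> ?E"
        by (simp add: \<phi>(4) \<psi>(4))
    qed
  qed
  then have "adjoin A B \<subseteq> ?E"
    using ring B by (intro adjoin_minimal) (auto simp: q_def)
  then show ?thesis
    using gen by (auto simp: q_def A_def)
qed

section \<open>Derivations determined on \<open>B\<close>, and their integration\<close>

section \<open>Integrability\<close>

lemma Der_power:
  assumes "\<delta> \<in> Der k"
  shows "\<delta> (x ^ n) = of_nat n * x ^ (n - 1) * \<delta> x"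
proof (induction n)
  case 0
  have "\<delta> (1 * 1) = 1 * \<delta> 1 + \<delta> 1 * 1"
    using assms unfolding Der_def by blast
  then show ?case by simp
next
  case (Suc n)
  have "\<delta> (x * x ^ n) = x * \<delta> (x ^ n) + \<delta> x * x ^ n"
    using assms unfolding Der_def by blast
  also have "\<dots> = of_nat (Suc n) * x ^ n * \<delta> x"
    \<comment> \<open>The case \<open>n = 0\<close> is separate because of the truncated subtraction
      in \<open>n - 1\<close>.\<close>
    unfolding Suc by (cases n) (simp_all add: algebra_simps)
  finally show ?case
    by simp
qed

text \<open>Both derivations vanish on \<open>k\<close> and, in characteristic \<open>p\<close>, on
  \<open>p\<close>-th powers, so their values on the generators \<open>B\<close> decide.\<close>

lemma Der_eqI:
  fixes k B :: "'a::comm_ring_1 set"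
  assumes p: "CHAR('a) = p" and gen: "adjoin (adjoin (pow_image p UNIV) k) B = UNIV"
    and \<delta>: "\<delta> \<in> Der k" and \<epsilon>: "\<epsilon> \<in> Der k" and B: "\<And>b. b \<in> B \<Longrightarrow> \<delta> b = \<epsilon> b"
  shows "\<delta> = \<epsilon>"
proof
  fix x
  have add: "\<delta> (x + y) = \<delta> x + \<delta> y" "\<epsilon> (x + y) = \<epsilon> x + \<epsilon> y" for x y
    using \<delta> \<epsilon> by (auto simp: Der_def k_linear_def)
  have diff: "\<delta> (x - y) = \<delta> x - \<delta> y" "\<epsilon> (x - y) = \<epsilon> x - \<epsilon> y" for x y
    using add [of "x - y" y] by simp_all
  have mult: "\<delta> (x * y) = x * \<delta> y + \<delta> x * y" "\<epsilon> (x * y) = x * \<epsilon> y + \<epsilon> x * y" for x y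
    using \<delta> \<epsilon> unfolding Der_def by blast+
  have one: "\<delta> 1 = 0" "\<epsilon> 1 = 0"
    using Der_power [OF \<delta>, of 1 0] Der_power [OF \<epsilon>, of 1 0] by simp_all
  have const: "\<delta> c = 0" "\<epsilon> c = 0" if "c \<in> k" for c
  proof -
    have "\<delta> (c * 1) = c * \<delta> 1" "\<epsilon> (c * 1) = c * \<epsilon> 1"
      using \<delta> \<epsilon> that unfolding Der_def k_linear_def by blast+
    then show "\<delta> c = 0" "\<epsilon> c = 0"
      by (simp_all add: one)
  qed
  have pow: "\<delta> (r ^ p) = 0" "\<epsilon> (r ^ p) = 0" for r
    using p by (auto simp: Der_power [OF \<delta>] Der_power [OF \<epsilon>])
  let ?E = "{x. \<delta> x = \<epsilon> x}"
  have ring: "is_subring ?E"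
    by (simp add: is_subring_def one diff mult)
  have "pow_image p UNIV \<subseteq> ?E" "k \<subseteq> ?E" "B \<subseteq> ?E"
    using pow const B by (auto simp: pow_image_def)
  then have "adjoin (adjoin (pow_image p UNIV) k) B \<subseteq> ?E"
    by (intro adjoin_minimal ring)
  then show "\<delta> x = \<epsilon> x"
    using gen by blast
qed

lemma HS_derivation_1_in_Der:
  assumes "HS_derivation k D"
  shows "D 1 \<in> Der k"
proof -
  have "D 1 (x * y) = x * D 1 y + D 1 x * y" for x y
  proof -
    have "D 1 (x * y) = (\<Sum>i\<le>1. D i x * D (1 - i) y)" and "D 0 = id"
      using assms unfolding HS_derivation_def by blast+
    then show ?thesis
      by simp
  qed
  moreover have "k_linear k (D 1)"
    using assms unfolding HS_derivation_def by blast
  ultimately show ?thesis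
    by (simp add: Der_def)
qed

lemma Der_eq_IDer:
  fixes k B :: "'a::comm_ring_1 set"
  assumes p: "prime p" "CHAR('a) = p" and basis: "\<And>e. pe_basis p e k B"
  shows "Der k = IDer k"
proof
  show "IDer k \<subseteq> Der k"
    by (auto simp: IDer_def)
next
  let ?A = "\<lambda>e. adjoin (pow_image (p ^ e) (UNIV :: 'a set)) k"
  show "Der k \<subseteq> IDer k"
  proof
    fix \<delta> assume \<delta>: "\<delta> \<in> Der k"
    define w where "w = (\<lambda>b. fps_const b + fps_const (\<delta> b) * fps_X)"
    have "\<exists>\<phi>. truncated_hom (p ^ e) (?A e) \<phi> \<and> (\<forall>b\<in>B. fps_cong (p ^ e) (\<phi> b) (w b))" for e
      by (rule truncated_hom_exists [OF p basis, of w e]) (auto simp: w_def)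
    then obtain \<phi> where \<phi>: "\<And>e. truncated_hom (p ^ e) (?A e) (\<phi> e)"
      and \<phi>_w: "\<And>e b. b \<in> B \<Longrightarrow> fps_cong (p ^ e) (\<phi> e b) (w b)"
      by metis
    have gen: "adjoin (?A e) B = UNIV" for e
      using basis by (simp add: pe_basis_def)
    have p1: "Suc 0 < p"
      using prime_gt_1_nat [OF p(1)] by simp
    \<comment> \<open>Both levels send \<open>b\<close> to \<open>w b\<close> to the respective
      order, so uniqueness at the lower level compares them.\<close>
    have compat: "fps_cong (p ^ e) (\<phi> e x) (\<phi> e' x)" if "e \<le> e'" for e e' x
    proof (rule truncated_hom_unique [OF p gen \<phi> \<phi>])
      show le: "p ^ e \<le> p ^ e'"
        using p1 that by simp
      show "k \<subseteq> ?A e'"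
        by (rule adjoin_superset)
      show "fps_cong (p ^ e) (\<phi> e b) (\<phi> e' b)" if "b \<in> B" for b
        using fps_cong_trans [OF \<phi>_w [OF that] fps_cong_sym [OF fps_cong_mono [OF \<phi>_w [OF that] le]]] .
    qed
    \<comment> \<open>Level \<open>n\<close> already determines coefficient \<open>n\<close>,
      because \<open>n < p ^ n\<close>. For the same reason the product rule for \<open>D n\<close>
      can be read off at that level.\<close>
    define D where "D = (\<lambda>n x. fps_nth (\<phi> n x) n)"
    have D: "D i x = fps_nth (\<phi> n x) i" if "i \<le> n" for i n x
      using compat [OF that, of x] power_gt_expt [OF p1, of i] by (simp add: D_def fps_cong_def)
    have "HS_derivation k D"
      unfolding HS_derivation_def
    proof (intro conjI allI)
      fix n
      have "fps_nth (\<phi> n (c * x)) n = c * fps_nth (\<phi> n x) n" if "c \<in> k" for c x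
        by (simp add: truncated_homD(3) [OF \<phi> subsetD [OF adjoin_superset(2) that]])
      then show "k_linear k (D n)"
        by (simp add: k_linear_def D_def truncated_homD(1) [OF \<phi>])
    next
      show "D 0 = id"
        by (simp add: fun_eq_iff D_def truncated_homD(6) [OF \<phi>])
    next
      fix n x y
      have "D n (x * y) = fps_nth (\<phi> n x * \<phi> n y) n"
        using truncated_homD(7) [OF \<phi>, of n x y] power_gt_expt [OF p1, of n]
        by (simp add: D_def fps_cong_def)
      also have "\<dots> = (\<Sum>i\<le>n. D i x * D (n - i) y)"
        by (simp add: fps_mult_nth D [where n = n] atLeast0AtMost)
      finally show "D n (x * y) = (\<Sum>i\<le>n. D i x * D (n - i) y)" .
    qed
    \<comment> \<open>Two derivations are compared on \<open>B\<close> only: as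
      \<open>1 < p\<close>, level 1 sees the coefficient of \<open>fps_X\<close> in
      \<open>w b\<close>, which is \<open>\<delta> b\<close>.\<close>
    moreover have "D 1 = \<delta>"
    proof (rule Der_eqI [OF p(2) _ HS_derivation_1_in_Der \<delta>])
      show "adjoin (adjoin (pow_image p UNIV) k) B = UNIV"
        using gen [of 1] by simp
      show "HS_derivation k D"
        by fact
      show "D 1 b = \<delta> b" if "b \<in> B" for b
        using \<phi>_w [OF that, of 1] p1 by (simp add: D_def fps_cong_def w_def)
    qed
    ultimately show "\<delta> \<in> IDer k"
      using \<delta> by (auto simp: IDer_def)
  qed
qed

theorem theorem4p3:
  fixes p :: nat and k B :: "'a::comm_ring_1 set"
  assumes "prime p" and "CHAR('a) = p"
    and "reduced_ring TYPE('a)"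
    and "is_subfield k"
    and "p_basis p k B"
    and "linearly_disjoint (pow_image p k) (pow_image p (UNIV :: 'a set)) k"
  shows "(\<forall>e\<ge>1. pe_basis p e k B) \<and> Der k = IDer k"
proof -
  have "pe_basis p e k B" for e
    using assms by (intro p_basis_imp_pe_basis)
  then show ?thesis
    using Der_eq_IDer [of p k B] assms(1,2) by blast
qed

end
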